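(* Let $\mathbf k\in(\mathbb N\cup\{\infty\})^\ell$. The ideal $\mathcal I\mathcal O^{\mathbf k}\subseteq\mathrm{NSym}^{(\ell)}$ equals the two-sided ideal generated by $\{\Phi_{\mathbf n}:\mathbf 0<\mathbf n\le\mathbf k,\ |\mathbf n|\text{ even}\}$. Dually, the $\mathbf k$-odd subalgebra $\mathcal O^{\mathbf k}\subseteq\mathrm{QSym}^{(\ell)}$ is the $\mathbb Q$-span of those $P_{(\mathbf i_1,\dots,\mathbf i_m)}$ such that for every $r$, $\mathbf i_r\le\mathbf k$ implies $|\mathbf i_r|$ is odd.
   Context: Fix $\ell\ge1$. $\mathbb N^\ell$: column vectors, weight $|\mathbf n|=\sum n_i$, coordinatewise order extended to $(\mathbb N\cup\{\infty\})^\ell$. Vector composition: sequence $\mathbf I=(\mathbf i_1,\dots,\mathbf i_m)$ of nonzero elements of $\mathbb N^\ell$. $\mathrm{QSym}^{(\ell)}$: $\mathbb Q$-span of $M_{\mathbf I}=\sum_{j_1<\dots<j_m}\mathbf x_{j_1}^{\mathbf i_1}\cdots\mathbf x_{j_m}^{\mathbf i_m}$ ($M_{()}=1$) in commuting variables $x_j^{(i)}$, $\mathbf x_j^{\mathbf n}=\prod_i(x_j^{(i)})^{n_i}$; $\mathbb N^\ell$-graded connected Hopf algebra with product of power series and deconcatenation coproduct $\Delta M_{\mathbf I}=\sum_{\mathbf I=\mathbf J\mathbf K}M_{\mathbf J}\otimes M_{\mathbf K}$. $\zeta_{\mathcal Q}$: character with $\zeta_{\mathcal Q}(M_{\mathbf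 I})=1$ if $\mathbf I$ has length $\le1$, else $0$; $\bar\zeta_{\mathcal Q}(h)=(-1)^{|\mathbf n|}\zeta_{\mathcal Q}(h)$ for $h$ of degree $\mathbf n$; $\zeta_{\mathcal Q}^{-1}$ its convolution inverse. $\mathrm{NSym}^{(\ell)}$ is the graded dual of $\mathrm{QSym}^{(\ell)}$, with basis $S^{\mathbf I}$ dual to $M_{\mathbf I}$; setting $S_{\mathbf n}=S^{(\mathbf n)}$, one has $S^{\mathbf I}=S_{\mathbf i_1}\cdots S_{\mathbf i_m}$, and the degree-$\mathbf n$ part of $\zeta_{\mathcal Q}$ is $S_{\mathbf n}$. $\Phi_{\mathbf n}$ defined by $\sum_{\mathbf n\ne\mathbf 0}\frac{\Phi_{\mathbf n}}{|\mathbf n|}t^{\mathbf n}=\log(1+\sum_{\mathbf n\ne\mathbf 0}S_{\mathbf n}t^{\mathbf n})$ with commuting $t_i$, $t^{\mathbf n}=\prod t_i^{n_i}$; $\Phi^{\mathbf I}=\Phi_{\mathbf i_1}\cdots\Phi_{\mathbf i_m}$ is a basis of $\mathrm{NSym}^{(\ell)}$ and $(P_{\mathbf I})$ is the dual basis of $\mathrm{QSym}^{(\ell)}$. $\mathcal I\mathcal O^{\mathbf k}$ is the ideal of $\mathrm{NSym}^{(\ell)}$ generated by $(\bar\zeta_{\mathcal Q})_{\mathbf n}-(\zeta_{\mathcal Q}^{-1})_{\mathbf n}$ for $\mathbf n\in\mathbb N^\ell$, $\mathbf n\le\mathbf k$ (subscript = restriction to degree $\mathbf n$). $\mathcal O^{\mathbf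 k}$ is the largest graded subcoalgebra $C$ of $\mathrm{QSym}^{(\ell)}$ such that $\bar\zeta_{\mathcal Q}(h)=\zeta_{\mathcal Q}^{-1}(h)$ for all $h\in C$ of degree $\le\mathbf k$. *)

theory Defs
  imports
    "HOL-Analysis.Finite_Cartesian_Product"
    "HOL-Library.Extended_Nat"
    "HOL-Library.Function_Algebras"
    "HOL-Library.Poly_Mapping"
    "HOL-Algebra.Ideal"
begin

section \<open>Vectors and vector compositions\<close>

text \<open>The number \<open>\<ell>\<close> of colours is the cardinality of the finite index type \<open>'l\<close>; the order on
  vectors is the library's coordinatewise order.\<close>

definition weight :: "nat ^ 'l::finite \<Rightarrow> nat" where
  "weight n = (\<Sum>i\<in>UNIV. n $ i)"

definition evec :: "nat ^ 'l::finite \<Rightarrow> enat ^ 'l" where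
  "evec n = (\<chi> i. enat (n $ i))"

definition compositions :: "(nat ^ 'l::finite) list set" where
  "compositions = {I. 0 \<notin> set I}"

section \<open>Quasisymmetric functions\<close>

definition fscale :: "rat \<Rightarrow> ('a \<Rightarrow> rat) \<Rightarrow> 'a \<Rightarrow> rat" where
  "fscale c f = (\<lambda>x. c * f x)"

global_interpretation fs: vector_space fscale
  by unfold_locales (auto simp: fscale_def fun_eq_iff algebra_simps)

text \<open>A monomial in the variables \<open>x\<^sub>j\<^sup>(\<^sup>i\<^sup>)\<close>, \<open>j \<in> \<nat>\<close>, is given by the finitely supported map sending
  \<open>j\<close> to the exponent vector of the \<open>j\<close>-th group of variables, and a formal power series by its
  coefficient function.\<close>

definition monom_at :: "nat list \<Rightarrow> (nat ^ 'l::finite) list \<Rightarrow> nat \<Rightarrow>\<^sub>0 nat ^ 'l" where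
  "monom_at js I = (\<Sum>(j, n) \<leftarrow> zip js I. Poly_Mapping.single j n)"

definition M_series :: "(nat ^ 'l::finite) list \<Rightarrow> (nat \<Rightarrow>\<^sub>0 nat ^ 'l) \<Rightarrow> rat" where
  "M_series I a =
     of_nat (card {js. length js = length I \<and> sorted_wrt (<) js \<and> monom_at js I = a})"

typedef (overloaded) 'l qsym =
  "fs.span (M_series ` compositions) :: ((nat \<Rightarrow>\<^sub>0 nat ^ 'l::finite) \<Rightarrow> rat) set"
  by (blast intro: fs.span_zero)

setup_lifting type_definition_qsym

instantiation qsym :: (finite) ab_group_add
begin
lift_definition zero_qsym :: "'a qsym" is 0 by (rule fs.span_zero)
lift_definition plus_qsym :: "'a qsym \<Rightarrow> 'a qsym \<Rightarrow> 'a qsym" is "(+)" by (rule fs.span_add)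
lift_definition uminus_qsym :: "'a qsym \<Rightarrow> 'a qsym" is uminus by (rule fs.span_neg)
lift_definition minus_qsym :: "'a qsym \<Rightarrow> 'a qsym \<Rightarrow> 'a qsym" is "(-)" by (rule fs.span_diff)
instance by standard (transfer; simp add: algebra_simps)+
end

lift_definition qscale :: "rat \<Rightarrow> 'l::finite qsym \<Rightarrow> 'l qsym" is fscale
  by (rule fs.span_scale)

global_interpretation qs: vector_space qscale
  by unfold_locales (transfer; auto simp: fscale_def fun_eq_iff algebra_simps)+

lift_definition qM :: "(nat ^ 'l::finite) list \<Rightarrow> 'l qsym" is
  "\<lambda>I. if I \<in> compositions then M_series I else 0"
  by (auto intro: fs.span_base fs.span_zero)

text \<open>The coefficient of \<open>M\<^sub>I\<close> in a quasisymmetric function is its coefficient at the first monomial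
  of \<open>M\<^sub>I\<close>; see \<open>mcoeff_qM\<close> and \<open>qsym_expansion\<close>.\<close>

definition mcoeff :: "'l::finite qsym \<Rightarrow> (nat ^ 'l) list \<Rightarrow> rat" where
  "mcoeff f I = (if I \<in> compositions then Rep_qsym f (monom_at [0..<length I] I) else 0)"

text \<open>Linear extension of a map given on the basis of all \<open>M\<^sub>I\<close>, with values in a space with scalar
  multiplication \<open>s\<close>.\<close>

definition mext ::
  "(rat \<Rightarrow> 'b \<Rightarrow> 'b) \<Rightarrow> ((nat ^ 'l::finite) list \<Rightarrow> 'b) \<Rightarrow> 'l qsym \<Rightarrow> 'b::comm_monoid_add" where
  "mext s g f = (\<Sum>I | mcoeff f I \<noteq> 0. s (mcoeff f I) (g I))"

lemma monom_at_Nil [simp]: "monom_at [] I = 0" "monom_at js [] = 0"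
  by (simp_all add: monom_at_def)

lemma monom_at_Cons [simp]:
  "monom_at (j # js) (n # I) = Poly_Mapping.single j n + monom_at js I"
  by (simp add: monom_at_def)

lemma lookup_monom_at_notin:
  "j \<notin> set js \<Longrightarrow> Poly_Mapping.lookup (monom_at js I) j = 0"
proof (induction js arbitrary: I)
  case (Cons a js)
  then show ?case by (cases I) (auto simp: lookup_add lookup_single)
qed simp

lemma lookup_monom_at_hd:
  "j \<notin> set js \<Longrightarrow> Poly_Mapping.lookup (monom_at (j # js) (n # I)) j = n"
  by (simp add: lookup_add lookup_monom_at_notin)

lemma monom_at_inject:
  assumes "length js = length I" "length ks = length J"
    and "sorted_wrt (<) js" "sorted_wrt (<) ks"
    and "I \<in> compositions" "J \<in> compositions"
    and "monom_at js I = monom_at ks J"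
  shows "js = ks \<and> I = J"
  using assms
proof (induction js arbitrary: I ks J)
  case Nil
  show ?case
  proof (cases ks)
    case Nil
    with Nil.prems show ?thesis by simp
  next
    case (Cons k ks')
    with Nil.prems obtain n J' where J: "J = n # J'" by (cases J) auto
    have "Poly_Mapping.lookup (monom_at ks J) k = n"
      using Nil.prems(4) unfolding Cons J by (intro lookup_monom_at_hd) auto
    with Nil.prems J show ?thesis by (auto simp: compositions_def)
  qed
next
  case (Cons j js)
  from Cons.prems obtain n I' where I: "I = n # I'" by (cases I) auto
  have lj: "Poly_Mapping.lookup (monom_at (j # js) I) j = n"
    using Cons.prems(3) unfolding I by (intro lookup_monom_at_hd) auto
  have n: "n \<noteq> 0" using Cons.prems I by (auto simp: compositions_def)
  obtain k ks' where ks: "ks = k # ks'"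
    using lj n Cons.prems by (cases ks) auto
  with Cons.prems obtain m J' where J: "J = m # J'" by (cases J) auto
  have lk: "Poly_Mapping.lookup (monom_at ks J) k = m"
    using Cons.prems(4) unfolding J ks by (intro lookup_monom_at_hd) auto
  have m: "m \<noteq> 0" using Cons.prems J by (auto simp: compositions_def)
  have "j \<in> set ks"
    using lj n Cons.prems(7) lookup_monom_at_notin[of j ks J] by auto
  moreover have "k \<in> set (j # js)"
    using lk m Cons.prems(7) lookup_monom_at_notin[of k "j # js" I] by auto
  ultimately have jk: "j = k" using Cons.prems(3,4) ks by force
  have nm: "n = m" using lj lk Cons.prems(7) jk by simp
  have "monom_at js I' = monom_at ks' J'"
    using Cons.prems(7) I J ks jk nm by simp
  then have "js = ks' \<and> I' = J'"
    using Cons.IH[of I' ks' J'] Cons.prems I J ks by (auto simp: compositions_def)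
  then show ?case using I J ks jk nm by simp
qed

lemma mcoeff_qM:
  assumes "J \<in> compositions"
  shows "mcoeff (qM J) I = (if I = J then 1 else 0)"
proof (cases "I \<in> compositions")
  case True
  have "{js. length js = length J \<and> sorted_wrt (<) js \<and> monom_at js J = monom_at [0..<length I] I}
      = (if I = J then {[0..<length I]} else {})"
    using monom_at_inject[of _ J "[0..<length I]" I] True assms by auto
  then show ?thesis
    using True assms by (simp add: mcoeff_def qM.rep_eq M_series_def)
qed (use assms in \<open>auto simp: mcoeff_def\<close>)

lemma mcoeff_0 [simp]: "mcoeff 0 I = 0"
  by (simp add: mcoeff_def zero_qsym.rep_eq)

lemma mcoeff_add: "mcoeff (f + g) I = mcoeff f I + mcoeff g I"
  by (simp add: mcoeff_def plus_qsym.rep_eq)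

lemma mcoeff_scale: "mcoeff (qscale c f) I = c * mcoeff f I"
  by (simp add: mcoeff_def qscale.rep_eq fscale_def)

lemma span_qM: "f \<in> qs.span (qM ` compositions)"
proof -
  have "Abs_qsym g \<in> qs.span (qM ` compositions) \<and> g \<in> fs.span (M_series ` compositions)"
    if "g \<in> fs.span (M_series ` compositions)" for g :: "(nat \<Rightarrow>\<^sub>0 nat ^ 'a) \<Rightarrow> rat"
    using that
  proof (induction rule: fs.span_induct_alt)
    case base
    have "Abs_qsym 0 = (0 :: 'a qsym)" by (simp add: zero_qsym_def)
    then show ?case by (metis qs.span_zero fs.span_zero)
  next
    case (step c x y)
    then obtain I where I: "x = M_series I" "I \<in> compositions" by auto
    have x: "x \<in> fs.span (M_series ` compositions)" using step(1) by (rule fs.span_base)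
    have "Rep_qsym (qscale c (qM I) + Abs_qsym y) = fscale c x + y"
      using I step(2) by (simp add: plus_qsym.rep_eq qscale.rep_eq qM.rep_eq Abs_qsym_inverse)
    then have "Abs_qsym (fscale c x + y) = qscale c (qM I) + Abs_qsym y"
      by (metis Rep_qsym_inverse)
    moreover have "qscale c (qM I) + Abs_qsym y \<in> qs.span (qM ` compositions)"
      using step(2) I by (intro qs.span_add qs.span_scale) (auto intro: qs.span_base)
    moreover have "fscale c x + y \<in> fs.span (M_series ` compositions)"
      using step(2) x by (intro fs.span_add fs.span_scale) auto
    ultimately show ?case by metis
  qed
  from this[OF Rep_qsym[of f]] show ?thesis by (simp add: Rep_qsym_inverse)
qed

lemma finite_mcoeff: "finite {I. mcoeff f I \<noteq> 0}"
proof -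
  have "f \<in> qs.span (qM ` compositions)" by (rule span_qM)
  then show ?thesis
  proof (induction rule: qs.span_induct_alt)
    case (step c x y)
    then obtain J where J: "x = qM J" "J \<in> compositions" by auto
    have "{I. mcoeff (qscale c x + y) I \<noteq> 0} \<subseteq> insert J {I. mcoeff y I \<noteq> 0}"
      using J by (auto simp: mcoeff_add mcoeff_scale mcoeff_qM split: if_splits)
    then show ?case using step by (meson finite_insert finite_subset)
  qed simp
qed

lemma mext_eq_sum:
  assumes "vector_space s" "finite A" "{I. mcoeff f I \<noteq> 0} \<subseteq> A"
  shows "mext s g f = (\<Sum>I\<in>A. s (mcoeff f I) (g I))"
proof -
  interpret vector_space s by fact
  show ?thesis
    unfolding mext_def by (rule sum.mono_neutral_left) (use assms in auto)
qed

lemma mext_linear: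
  fixes s :: "rat \<Rightarrow> 'b::ab_group_add \<Rightarrow> 'b"
  assumes "vector_space s"
  shows "Vector_Spaces.linear qscale s (mext s g)"
proof -
  interpret s: vector_space s by fact
  show ?thesis
    unfolding linear_iff_module_hom module_hom_iff module_iff_vector_space
  proof (intro conjI allI)
    show "vector_space (qscale :: rat \<Rightarrow> 'a qsym \<Rightarrow> 'a qsym)" by unfold_locales
    show "vector_space s" by fact
  next
    fix f h :: "'a qsym"
    let ?A = "{I. mcoeff f I \<noteq> 0} \<union> {I. mcoeff h I \<noteq> 0}"
    have A: "finite ?A" by (simp add: finite_mcoeff)
    have "{I. mcoeff (f + h) I \<noteq> 0} \<subseteq> ?A" by (auto simp: mcoeff_add)
    then show "mext s g (f + h) = mext s g f + mext s g h"
      by (subst (1 2 3) mext_eq_sum[OF assms A])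
        (auto simp: mcoeff_add s.scale_left_distrib sum.distrib)
  next
    fix c :: rat and f :: "'a qsym"
    let ?A = "{I. mcoeff f I \<noteq> 0}"
    have A: "finite ?A" by (simp add: finite_mcoeff)
    have "{I. mcoeff (qscale c f) I \<noteq> 0} \<subseteq> ?A" by (auto simp: mcoeff_scale)
    then show "mext s g (qscale c f) = s c (mext s g f)"
      by (subst (1 2) mext_eq_sum[OF assms A])
        (auto simp: mcoeff_scale s.scale_sum_right)
  qed
qed

lemma mext_qM:
  assumes "vector_space s" "I \<in> compositions"
  shows "mext s g (qM I) = g I"
proof -
  interpret vector_space s by fact
  show ?thesis
    by (subst mext_eq_sum[OF assms(1), of "{I}"]) (auto simp: mcoeff_qM[OF assms(2)])
qed

lemma qsym_expansion: "f = (\<Sum>I | mcoeff f I \<noteq> 0. qscale (mcoeff f I) (qM I))"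
proof -
  interpret vector_space_pair qscale qscale by unfold_locales
  have lin: "Vector_Spaces.linear qscale qscale (mext qscale qM)"
    by (rule mext_linear) unfold_locales
  have "vector_space (qscale :: rat \<Rightarrow> 'a qsym \<Rightarrow> 'a qsym)" by unfold_locales
  have "f \<in> qs.span (qM ` compositions)" by (rule span_qM)
  then have "mext qscale qM f = f"
  proof (induction rule: qs.span_induct_alt)
    case base
    show ?case using linear_0[OF lin] .
  next
    case (step c x y)
    then show ?case
      using mext_qM[OF \<open>vector_space qscale\<close>]
      by (auto simp: linear_add[OF lin] linear_scale[OF lin])
  qed
  then show ?thesis by (simp add: mext_def)
qed

section \<open>Grading, coproduct and graded subcoalgebras\<close>

definition homog :: "nat ^ 'l::finite \<Rightarrow> 'l qsym set" where
  "homog n = qs.span (qM ` {I \<in> compositions. sum_list I = n})"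

definition hcomp :: "nat ^ 'l::finite \<Rightarrow> 'l qsym \<Rightarrow> 'l qsym" where
  "hcomp n = mext qscale (\<lambda>I. if sum_list I = n then qM I else 0)"

text \<open>An element of \<open>QSym \<otimes> QSym\<close> is given by its coordinates in the basis \<open>M\<^sub>J \<otimes> M\<^sub>K\<close>.\<close>

definition tens :: "'l::finite qsym \<Rightarrow> 'l qsym \<Rightarrow> (nat ^ 'l) list \<times> (nat ^ 'l) list \<Rightarrow> rat" where
  "tens f g = (\<lambda>(J, K). mcoeff f J * mcoeff g K)"

definition coprod :: "'l::finite qsym \<Rightarrow> (nat ^ 'l) list \<times> (nat ^ 'l) list \<Rightarrow> rat" where
  "coprod = mext fscale (\<lambda>I. \<Sum>(J, K) | J @ K = I. tens (qM J) (qM K))"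

definition counit :: "'l::finite qsym \<Rightarrow> rat" where
  "counit = mext (*) (\<lambda>I. if I = [] then 1 else 0)"

definition graded_subcoalgebra :: "'l::finite qsym set \<Rightarrow> bool" where
  "graded_subcoalgebra C \<longleftrightarrow>
     qs.subspace C \<and>
     (\<forall>f\<in>C. \<forall>n. hcomp n f \<in> C) \<and>
     (\<forall>f\<in>C. coprod f \<in> fs.span {tens g h | g h. g \<in> C \<and> h \<in> C})"

section \<open>Convolution and noncommutative symmetric functions\<close>

definition tens_eval :: "('l::finite qsym \<Rightarrow> rat) \<Rightarrow> ('l qsym \<Rightarrow> rat) \<Rightarrow>
    ((nat ^ 'l) list \<times> (nat ^ 'l) list \<Rightarrow> rat) \<Rightarrow> rat" where
  "tens_eval \<phi> \<psi> T = (\<Sum>(J, K) | T (J, K) \<noteq> 0. T (J, K) * (\<phi> (qM J) * \<psi> (qM K)))"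

definition conv :: "('l::finite qsym \<Rightarrow> rat) \<Rightarrow> ('l qsym \<Rightarrow> rat) \<Rightarrow> 'l qsym \<Rightarrow> rat" where
  "conv \<phi> \<psi> f = tens_eval \<phi> \<psi> (coprod f)"

definition NSym :: "('l::finite qsym \<Rightarrow> rat) ring" where
  "NSym =
     \<lparr>carrier = {\<phi>. Vector_Spaces.linear qscale (*) \<phi> \<and> finite {n. \<exists>h\<in>homog n. \<phi> h \<noteq> 0}},
      mult = conv, one = counit, zero = 0, add = (+)\<rparr>"

definition nS :: "(nat ^ 'l::finite) list \<Rightarrow> 'l qsym \<Rightarrow> rat" where
  "nS I = mext (*) (\<lambda>J. if J = I then 1 else 0)"

text \<open>Formal power series in commuting variables \<open>t\<^sub>i\<close>, given by the coefficient of each \<open>t\<^sup>n\<close>.\<close>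

definition ser_mult :: "(nat ^ 'l::finite \<Rightarrow> 'l qsym \<Rightarrow> rat) \<Rightarrow> (nat ^ 'l \<Rightarrow> 'l qsym \<Rightarrow> rat) \<Rightarrow>
    nat ^ 'l \<Rightarrow> 'l qsym \<Rightarrow> rat" where
  "ser_mult F G n = (\<Sum>(a, b) | a + b = n. conv (F a) (G b))"

primrec ser_pow :: "(nat ^ 'l::finite \<Rightarrow> 'l qsym \<Rightarrow> rat) \<Rightarrow> nat \<Rightarrow> nat ^ 'l \<Rightarrow> 'l qsym \<Rightarrow> rat" where
  "ser_pow F 0 = (\<lambda>n. if n = 0 then counit else 0)"
| "ser_pow F (Suc r) = ser_mult F (ser_pow F r)"

text \<open>The logarithm of \<open>1 + F\<close> for a series \<open>F\<close> without constant term; by \<open>ser_pow_eq_0\<close> the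
  powers \<open>F\<^sup>r\<close> with \<open>r > |n|\<close> do not contribute to the coefficient of \<open>t\<^sup>n\<close>.\<close>

definition ser_log1p :: "(nat ^ 'l::finite \<Rightarrow> 'l qsym \<Rightarrow> rat) \<Rightarrow> nat ^ 'l \<Rightarrow> 'l qsym \<Rightarrow> rat" where
  "ser_log1p F n = (\<Sum>r = 1..weight n. fscale ((-1) ^ (r - 1) / of_nat r) (ser_pow F r n))"

definition nPhi :: "nat ^ 'l::finite \<Rightarrow> 'l qsym \<Rightarrow> rat" where
  "nPhi n = fscale (of_nat (weight n)) (ser_log1p (\<lambda>m. if m = 0 then 0 else nS [m]) n)"

definition nPhi_prod :: "(nat ^ 'l::finite) list \<Rightarrow> 'l qsym \<Rightarrow> rat" where
  "nPhi_prod I = foldr (\<lambda>n \<phi>. conv (nPhi n) \<phi>) I counit"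

definition qP :: "(nat ^ 'l::finite) list \<Rightarrow> 'l qsym" where
  "qP I = (THE p. \<forall>J\<in>compositions. nPhi_prod J p = (if J = I then 1 else 0))"

lemma conv_qM:
  assumes "I \<in> compositions"
  shows "conv \<phi> \<psi> (qM I) = (\<Sum>(J, K) | J @ K = I. \<phi> (qM J) * \<psi> (qM K))"
proof -
  let ?A = "{(J, K). J @ K = I}"
  have fin: "finite ?A"
  proof (rule finite_subset)
    show "?A \<subseteq> (\<lambda>r. (take r I, drop r I)) ` {..length I}"
    proof clarify
      fix J K :: "(nat ^ 'a) list"
      show "(J, K) \<in> (\<lambda>r. (take r (J @ K), drop r (J @ K))) ` {..length (J @ K)}"
        by (rule image_eqI[of _ _ "length J"]) auto
    qed
  qed simp
  have cop: "coprod (qM I) = (\<Sum>(J, K) | J @ K = I. tens (qM J) (qM K))"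
    unfolding coprod_def by (rule mext_qM) (unfold_locales, fact)
  have ten: "tens (qM J) (qM K) p = (if p = (J, K) then 1 else 0)" if "J @ K = I" for J K p
  proof -
    have "J \<in> compositions" "K \<in> compositions" using that assms by (auto simp: compositions_def)
    then show ?thesis by (cases p) (auto simp: tens_def mcoeff_qM)
  qed
  have app: "(\<Sum>p\<in>?A. f p) q = (\<Sum>p\<in>?A. f p q)" for f :: "_ \<Rightarrow> _ \<Rightarrow> rat" and q
    using fin by (induction rule: finite_induct) auto
  have "coprod (qM I) p = (\<Sum>q\<in>?A. if p = q then 1 else 0)" for p
    unfolding cop app by (rule sum.cong) (auto simp: ten)
  then have co: "coprod (qM I) p = (if p \<in> ?A then 1 else 0)" for p
    by (simp add: fin)
  then show ?thesis
    unfolding conv_def tens_eval_def by (intro sum.cong) (auto split: if_splits)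
qed

lemma conv_0 [simp]: "conv 0 \<psi> = 0" "conv \<phi> 0 = 0"
  by (auto simp: fun_eq_iff conv_def tens_eval_def intro!: sum.neutral)

lemma weight_add: "weight (a + b) = weight a + weight b"
  by (simp add: weight_def sum.distrib)

lemma weight_eq_0_iff: "weight n = 0 \<longleftrightarrow> n = 0"
  by (simp add: weight_def vec_eq_iff)

lemma ser_pow_eq_0:
  assumes "F 0 = 0" "weight n < r"
  shows "ser_pow F r n = 0"
  using assms(2)
proof (induction r arbitrary: n)
  case (Suc r)
  have "conv (F a) (ser_pow F r b) = 0" if "a + b = n" for a b
  proof (cases "a = 0")
    case False
    then have "weight b < r"
      using that Suc.prems weight_add[of a b] weight_eq_0_iff[of a] by auto
    then show ?thesis by (metis Suc.IH conv_0(2))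
  qed (simp add: assms(1))
  then show ?case
    unfolding ser_pow.simps ser_mult_def by (intro sum.neutral) auto
qed simp

section \<open>Characters and the odd ideal and subalgebra\<close>

definition zeta :: "'l::finite qsym \<Rightarrow> rat" where
  "zeta = mext (*) (\<lambda>I. if length I \<le> 1 then 1 else 0)"

definition zeta_bar :: "'l::finite qsym \<Rightarrow> rat" where
  "zeta_bar = mext (*) (\<lambda>I. (-1) ^ weight (sum_list I) * zeta (qM I))"

definition zeta_inv :: "'l::finite qsym \<Rightarrow> rat" where
  "zeta_inv = (THE \<psi>. Vector_Spaces.linear qscale (*) \<psi> \<and>
                      conv zeta \<psi> = counit \<and> conv \<psi> zeta = counit)"

definition deg_part :: "nat ^ 'l::finite \<Rightarrow> ('l qsym \<Rightarrow> rat) \<Rightarrow> 'l qsym \<Rightarrow> rat" where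
  "deg_part n \<phi> = (\<lambda>f. \<phi> (hcomp n f))"

definition odd_ideal :: "enat ^ 'l::finite \<Rightarrow> ('l qsym \<Rightarrow> rat) set" where
  "odd_ideal k = genideal NSym {deg_part n zeta_bar - deg_part n zeta_inv | n. evec n \<le> k}"

definition odd_subalgebra :: "enat ^ 'l::finite \<Rightarrow> 'l qsym set" where
  "odd_subalgebra k = (GREATEST C. graded_subcoalgebra C \<and>
     (\<forall>n. evec n \<le> k \<longrightarrow> (\<forall>h \<in> C \<inter> homog n. zeta_bar h = zeta_inv h)))"

end

theory Submission
  imports Defs "HOL-Computational_Algebra.Formal_Power_Series"
begin

text \<open>
  Write \<open>\<zeta>\<close>, \<open>\<zeta>'\<close> for the characters \<open>\<zeta>\<^sub>Q\<close> and \<open>\<zeta>\<^sub>Q\<close> with signs, as series in \<open>t\<close> over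
  \<open>NSym\<close>, and \<open>\<phi>\<^sub>n = \<Phi>\<^sub>n / |n|\<close>, the coefficients of \<open>log \<zeta>\<close>. The substitution of signs gives
  \<open>log \<zeta>' = \<Sum> (-1)\<^bsup>|n|\<^esup> \<phi>\<^sub>n t\<^sup>n\<close>, and \<open>log (1/y) = - log y\<close> gives \<open>log \<zeta>\<^sup>-\<^sup>1 = - \<Sum> \<phi>\<^sub>n t\<^sup>n\<close>. Hence
  \<open>log \<zeta>' - log \<zeta>\<^sup>-\<^sup>1\<close> has coefficient \<open>2 \<phi>\<^sub>n\<close> for \<open>|n|\<close> even and \<open>0\<close> for \<open>|n|\<close> odd. The degree \<open>n\<close> part
  of a logarithm is its argument in degree \<open>n\<close> plus products of parts of lower degree, so modulo an
  ideal the two series agree in all degrees \<open>n \<le> k\<close> if and only if their logarithms do.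

  For the dual statement, the annihilator of a subcoalgebra is an ideal of \<open>NSym\<close>. A graded
  subcoalgebra \<open>C\<close> therefore satisfies the oddness condition iff its annihilator contains every
  \<open>\<Phi>\<^sub>n\<close> with \<open>n \<le> k\<close> of even weight, and then it contains every product \<open>\<Phi>\<^sup>I\<close> having such a factor; in
  the dual basis \<open>P\<^sub>I\<close> this says that \<open>C\<close> lies in the span of the remaining \<open>P\<^sub>I\<close>. That span is itself
  a subcoalgebra because \<open>\<Delta> P\<^sub>I = \<Sum>\<^bsub>I = JK\<^esub> P\<^sub>J \<otimes> P\<^sub>K\<close>.
\<close>

section \<open>Compositions and linear functionals\<close>

lemma sum_apply: "(\<Sum>x\<in>A. F x) y = (\<Sum>x\<in>A. F x y)" for F :: "'a \<Rightarrow> 'b \<Rightarrow> 'c::comm_monoid_add"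
  by (induction A rule: infinite_finite_induct) auto

lemma Nil_composition [simp]: "[] \<in> compositions"
  by (simp add: compositions_def)

lemma Cons_composition [simp]: "n # I \<in> compositions \<longleftrightarrow> n \<noteq> 0 \<and> I \<in> compositions"
  by (auto simp: compositions_def)

lemma append_composition [simp]:
  "I @ J \<in> compositions \<longleftrightarrow> I \<in> compositions \<and> J \<in> compositions"
  by (auto simp: compositions_def)

lemma take_drop_composition:
  assumes "I \<in> compositions"
  shows "take r I \<in> compositions" "drop r I \<in> compositions"
  using assms by (auto simp: compositions_def dest: in_set_takeD in_set_dropD)

lemma weight_0 [simp]: "weight 0 = 0"
  by (simp add: weight_eq_0_iff)

lemma vec_less_imp_weight_less:
  assumes "m < n" shows "weight m < weight n"
proof -
  have "m \<le> n" using assms by simp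
  then have le: "\<And>i. m $ i \<le> n $ i" by (simp add: less_eq_vec_def)
  obtain i where "\<not> n $ i \<le> m $ i" using assms by (auto simp: less_vec_def less_eq_vec_def)
  then show ?thesis unfolding weight_def using le
    by (intro sum_strict_mono_ex1) (auto intro!: exI[of _ i] simp: not_le)
qed

lemma nat_vec_pos_iff [simp]: "0 < n \<longleftrightarrow> n \<noteq> 0" for n :: "nat ^ 'l::finite"
  by (auto simp: less_vec_def less_eq_vec_def vec_eq_iff)

lemma nat_vec_add_le: "a \<le> a + b" "b \<le> a + b" for a b :: "nat ^ 'l::finite"
  by (auto simp: less_eq_vec_def)

text \<open>The degrees below k are closed downwards, so arguments by induction on the degree never
  leave the range of the generators.\<close>

lemma evec_mono: "m \<le> n \<Longrightarrow> evec n \<le> k \<Longrightarrow> evec m \<le> k"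
  unfolding less_eq_vec_def evec_def by (auto intro: order_trans[OF enat_ord_simps(1)[THEN iffD2]])

lemma finite_nat_vec_le: "finite {a. a \<le> n}" for n :: "nat ^ 'l::finite"
proof (rule inj_on_finite)
  show "inj_on vec_nth {a. a \<le> n}" by (simp add: inj_on_def vec_nth_inject)
  show "vec_nth ` {a. a \<le> n} \<subseteq> PiE UNIV (\<lambda>i. {..n $ i})"
    by (auto simp: less_eq_vec_def)
qed (auto intro: finite_PiE)

lemma finite_nat_vec_add: "finite {(a, b). a + b = n}" for n :: "nat ^ 'l::finite"
proof (rule finite_subset)
  show "{(a, b). a + b = n} \<subseteq> {a. a \<le> n} \<times> {b. b \<le> n}"
    by (auto simp: nat_vec_add_le)
qed (simp add: finite_nat_vec_le)

text \<open>Every part is nonzero and so has weight at least 1. This bounds both the number of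
  compositions of a degree and the powers that matter in a logarithm.\<close>

lemma length_le_weight: "I \<in> compositions \<Longrightarrow> length I \<le> weight (sum_list I)"
proof (induction I)
  case (Cons n I)
  then show ?case using weight_eq_0_iff[of n] by (auto simp: weight_add)
qed simp

lemma composition_sum_eq_0: "I \<in> compositions \<Longrightarrow> sum_list I = 0 \<longleftrightarrow> I = []"
  using length_le_weight[of I] by auto

lemma member_le_sum_list_vec: "a \<in> set I \<Longrightarrow> a \<le> sum_list I" for I :: "(nat ^ 'l::finite) list"
  by (induction I) (auto intro: nat_vec_add_le order_trans)

lemma finite_compositions_of: "finite {I \<in> compositions. sum_list I = n}"
proof (rule finite_subset)
  show "{I \<in> compositions. sum_list I = n} \<subseteq> {I. set I \<subseteq> {a. a \<le> n} \<and> length I \<le> weight n}"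
    using length_le_weight member_le_sum_list_vec by blast
qed (simp add: finite_lists_length_le finite_nat_vec_le)

lemma finite_splits: "finite {(J, K). J @ K = I}"
proof (rule finite_subset)
  show "{(J, K). J @ K = I} \<subseteq> (\<lambda>r. (take r I, drop r I)) ` {..length I}"
  proof clarify
    fix J K :: "'a list"
    show "(J, K) \<in> (\<lambda>r. (take r (J @ K), drop r (J @ K))) ` {..length (J @ K)}"
      by (rule image_eqI[of _ _ "length J"]) auto
  qed
qed simp

lemma sum_splits:
  "(\<Sum>(J, K) | J @ K = I. F J K) = (\<Sum>r\<le>length I. F (take r I) (drop r I))"
  by (rule sum.reindex_bij_witness[of _ "\<lambda>r. (take r I, drop r I)" "\<lambda>(J, K). length J"]) auto

section \<open>Linear functionals on QSym, determined by their values on the M_I\<close>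

abbreviation dual :: "('l::finite qsym \<Rightarrow> rat) \<Rightarrow> bool" where
  "dual \<equiv> Vector_Spaces.linear qscale (*)"

lemma vector_space_rat: "vector_space ((*) :: rat \<Rightarrow> rat \<Rightarrow> rat)"
  by unfold_locales (auto simp: algebra_simps)

lemma vector_space_qscale: "vector_space (qscale :: rat \<Rightarrow> 'l::finite qsym \<Rightarrow> 'l qsym)"
  by unfold_locales

lemma vector_space_fscale: "vector_space fscale"
  by unfold_locales

lemma dual_iff:
  "dual \<phi> \<longleftrightarrow> (\<forall>f g. \<phi> (f + g) = \<phi> f + \<phi> g) \<and> (\<forall>c f. \<phi> (qscale c f) = c * \<phi> f)"
  using vector_space_rat vector_space_qscale
  by (auto simp: linear_iff_module_hom module_hom_iff module_iff_vector_space)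

lemma dual_add: "dual \<phi> \<Longrightarrow> \<phi> (f + g) = \<phi> f + \<phi> g"
  by (simp add: dual_iff)

lemma dual_scale: "dual \<phi> \<Longrightarrow> \<phi> (qscale c f) = c * \<phi> f"
  by (simp add: dual_iff)

lemma dual_0: "dual \<phi> \<Longrightarrow> \<phi> 0 = 0"
  using dual_scale[of \<phi> 0 0] by simp

lemma dual_sum: "dual \<phi> \<Longrightarrow> \<phi> (\<Sum>x\<in>A. f x) = (\<Sum>x\<in>A. \<phi> (f x))"
  by (induction A rule: infinite_finite_induct) (auto simp: dual_0 dual_add)

lemma dual_diff: "dual \<phi> \<Longrightarrow> \<phi> (f - g) = \<phi> f - \<phi> g"
  using dual_add[of \<phi> "f - g" g] by simp

lemma dual_span_eq_0:
  assumes "dual \<phi>" "\<And>f. f \<in> B \<Longrightarrow> \<phi> f = 0" "f \<in> qs.span B"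
  shows "\<phi> f = 0"
  using assms(3)
  by (induction rule: qs.span_induct_alt) (auto simp: assms dual_0 dual_add dual_scale)

lemma dual_eqI:
  assumes "dual \<phi>" "dual \<psi>" "\<And>I. I \<in> compositions \<Longrightarrow> \<phi> (qM I) = \<psi> (qM I)"
  shows "\<phi> = \<psi>"
proof
  fix f show "\<phi> f = \<psi> f"
    using span_qM[of f]
    by (induction rule: qs.span_induct_alt)
      (auto simp: assms dual_0[OF assms(1)] dual_0[OF assms(2)] dual_add[OF assms(1)]
        dual_add[OF assms(2)] dual_scale[OF assms(1)] dual_scale[OF assms(2)])
qed

lemma dual_expansion:
  assumes "dual \<phi>"
  shows "\<phi> f = (\<Sum>I | mcoeff f I \<noteq> 0. mcoeff f I * \<phi> (qM I))"
  by (subst qsym_expansion[of f]) (simp add: dual_sum dual_scale assms)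

lemma dual_mext [simp, intro]: "dual (mext (*) g)"
  by (rule mext_linear) (rule vector_space_rat)

lemma mext_rat_qM [simp]: "I \<in> compositions \<Longrightarrow> mext (*) g (qM I) = g I"
  by (rule mext_qM) (rule vector_space_rat)

lemma dual_zero [simp, intro]: "dual 0"
  by (simp add: dual_iff)

lemma dual_plus [intro]: "dual \<phi> \<Longrightarrow> dual \<psi> \<Longrightarrow> dual (\<phi> + \<psi>)"
  by (simp add: dual_iff algebra_simps)

lemma dual_uminus [intro]: "dual \<phi> \<Longrightarrow> dual (- \<phi>)"
  by (simp add: dual_iff algebra_simps)

lemma dual_minus [intro]: "dual \<phi> \<Longrightarrow> dual \<psi> \<Longrightarrow> dual (\<phi> - \<psi>)"
  by (simp add: dual_iff algebra_simps)

lemma fscale_apply: "fscale c f x = c * f x"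
  by (simp add: fscale_def)

lemma dual_fscale [intro]: "dual \<phi> \<Longrightarrow> dual (fscale c \<phi>)"
  by (simp add: dual_iff algebra_simps fscale_def)

lemma dual_sumI [intro]: "(\<And>x. x \<in> A \<Longrightarrow> dual (\<phi> x)) \<Longrightarrow> dual (\<Sum>x\<in>A. \<phi> x)"
  by (induction A rule: infinite_finite_induct) auto

lemma mcoeff_dual: "dual (\<lambda>f. mcoeff f I)"
  by (simp add: dual_iff mcoeff_add mcoeff_scale)

section \<open>Coproduct and convolution\<close>

lemma mcoeff_nonzero_composition: "mcoeff f I \<noteq> 0 \<Longrightarrow> I \<in> compositions"
  by (simp add: mcoeff_def split: if_splits)

lemma linear_coprod: "Vector_Spaces.linear qscale fscale (coprod :: 'l::finite qsym \<Rightarrow> _)"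
  unfolding coprod_def by (rule mext_linear) (rule vector_space_fscale)

lemma coprod_add: "coprod (f + g) = coprod f + coprod g" for f g :: "'l::finite qsym"
  using linear_coprod[where 'l = 'l] by (simp add: linear_iff_module_hom module_hom_iff)

lemma coprod_scale: "coprod (qscale c f) = fscale c (coprod f)" for f :: "'l::finite qsym"
  using linear_coprod[where 'l = 'l] by (simp add: linear_iff_module_hom module_hom_iff)

text \<open>Both sides are linear in f, and on M_I at most one cut of I can produce the pair (J,
  K).\<close>

lemma coprod_apply: "coprod f (J, K) = mcoeff f (J @ K)"
proof -
  have "dual (\<lambda>f. coprod f (J, K))"
    by (simp add: dual_iff coprod_add coprod_scale fscale_def)
  moreover have "coprod (qM I) (J, K) = mcoeff (qM I) (J @ K)" if I: "I \<in> compositions" for I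
  proof -
    have "coprod (qM I) (J, K) = (\<Sum>(J', K') | J' @ K' = I. tens (qM J') (qM K')) (J, K)"
      unfolding coprod_def by (subst mext_qM[OF vector_space_fscale I]) rule
    also have "\<dots> = (\<Sum>p | fst p @ snd p = I. if p = (J, K) then 1 else 0)"
      unfolding sum_apply
      by (rule sum.cong) (use I in \<open>auto simp: tens_def mcoeff_qM split: if_splits\<close>)
    also have "\<dots> = (if J @ K = I then 1 else 0)"
      using finite_splits[of I] by (simp add: split_def)
    finally show ?thesis using I by (simp add: mcoeff_qM)
  qed
  ultimately have "(\<lambda>f. coprod f (J, K)) = (\<lambda>f. mcoeff f (J @ K))"
    by (intro dual_eqI mcoeff_dual)
  then show ?thesis by metis
qed

lemma finite_coprod: "finite {p. coprod f p \<noteq> 0}"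
proof (rule finite_subset)
  show "{p. coprod f p \<noteq> 0} \<subseteq> (\<Union>I\<in>{I. mcoeff f I \<noteq> 0}. {(J, K). J @ K = I})"
    by (auto simp: coprod_apply)
qed (auto simp: finite_mcoeff finite_splits)

lemma tens_eval_eq_sum:
  assumes "finite A" "{p. T p \<noteq> 0} \<subseteq> A"
  shows "tens_eval \<phi> \<psi> T = (\<Sum>p\<in>A. T p * (\<phi> (qM (fst p)) * \<psi> (qM (snd p))))"
  unfolding tens_eval_def case_prod_beta prod.collapse
  by (rule sum.mono_neutral_left) (use assms in auto)

text \<open>\<open>tens_eval\<close> sums over the support, and a sum over an infinite set is 0 by
  convention; additivity therefore rests on finite supports.\<close>

lemma tens_eval_add:
  assumes "finite {p. T p \<noteq> 0}" "finite {p. U p \<noteq> 0}"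
  shows "tens_eval \<phi> \<psi> (T + U) = tens_eval \<phi> \<psi> T + tens_eval \<phi> \<psi> U"
proof -
  let ?A = "{p. T p \<noteq> 0} \<union> {p. U p \<noteq> 0}"
  have "finite ?A" using assms by simp
  then show ?thesis
    by (subst (1 2 3) tens_eval_eq_sum[of ?A]) (auto simp: algebra_simps sum.distrib)
qed

lemma tens_eval_scale: "tens_eval \<phi> \<psi> (fscale c T) = c * tens_eval \<phi> \<psi> T"
proof (cases "c = 0")
  case True
  then show ?thesis by (simp add: tens_eval_def fscale_def)
next
  case False
  then show ?thesis by (simp add: tens_eval_def fscale_def sum_distrib_left mult.assoc case_prod_beta)
qed

lemma tens_eval_0 [simp]: "tens_eval \<phi> \<psi> 0 = 0"
  by (simp add: tens_eval_def)

lemma finite_tens: "finite {p. tens f g p \<noteq> 0}"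
proof (rule finite_subset)
  show "{p. tens f g p \<noteq> 0} \<subseteq> {I. mcoeff f I \<noteq> 0} \<times> {I. mcoeff g I \<noteq> 0}"
    by (auto simp: tens_def)
qed (simp add: finite_mcoeff)

lemma tens_eval_tens:
  assumes "dual \<phi>" "dual \<psi>"
  shows "tens_eval \<phi> \<psi> (tens f g) = \<phi> f * \<psi> g"
proof -
  let ?A = "{I. mcoeff f I \<noteq> 0}" and ?B = "{I. mcoeff g I \<noteq> 0}"
  have "tens_eval \<phi> \<psi> (tens f g) = (\<Sum>p\<in>?A \<times> ?B. tens f g p * (\<phi> (qM (fst p)) * \<psi> (qM (snd p))))"
    by (rule tens_eval_eq_sum) (auto simp: finite_mcoeff tens_def)
  also have "\<dots> = (\<Sum>J\<in>?A. \<Sum>K\<in>?B. (mcoeff f J * \<phi> (qM J)) * (mcoeff g K * \<psi> (qM K)))"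
    unfolding sum.cartesian_product by (rule sum.cong) (auto simp: tens_def)
  also have "\<dots> = \<phi> f * \<psi> g"
    by (simp add: dual_expansion[OF assms(1), of f] dual_expansion[OF assms(2), of g] sum_product)
  finally show ?thesis .
qed

lemma dual_conv [simp, intro]: "dual (conv \<phi> \<psi>)"
  by (simp add: dual_iff conv_def coprod_add coprod_scale tens_eval_add tens_eval_scale finite_coprod)

lemma conv_qM_take_drop:
  assumes "I \<in> compositions"
  shows "conv \<phi> \<psi> (qM I) = (\<Sum>r\<le>length I. \<phi> (qM (take r I)) * \<psi> (qM (drop r I)))"
  unfolding conv_qM[OF assms] by (rule sum_splits)

text \<open>On M_I both sides run over the factorizations of I into three consecutive blocks; only
  the order of cutting differs.\<close>

lemma conv_assoc: "conv (conv \<phi> \<psi>) \<xi> = conv \<phi> (conv \<psi> \<xi>)"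
proof (rule dual_eqI)
  fix I :: "(nat ^ 'a) list" assume I: "I \<in> compositions"
  let ?f = "\<lambda>J K L. \<phi> (qM J) * \<psi> (qM K) * \<xi> (qM L)"
  have fin: "finite {p. fst p @ snd p = L}" for L :: "(nat ^ 'a) list"
    using finite_splits[of L] by (simp add: split_def)
  have "conv (conv \<phi> \<psi>) \<xi> (qM I)
      = (\<Sum>p | fst p @ snd p = I. \<Sum>q | fst q @ snd q = fst p. ?f (fst q) (snd q) (snd p))"
    unfolding conv_qM[OF I] split_def
    by (rule sum.cong) (use I in \<open>auto simp: conv_qM sum_distrib_right split_def\<close>)
  also have "\<dots> = (\<Sum>p | fst p @ snd p = I. \<Sum>q | fst q @ snd q = snd p. ?f (fst p) (fst q) (snd q))"
    unfolding sum.Sigma[OF fin ballI[OF fin]]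
    by (rule sum.reindex_bij_witness[of _ "\<lambda>(p, q). ((fst p @ fst q, snd q), (fst p, fst q))"
          "\<lambda>(p, q). ((fst q, snd q @ snd p), (snd q, snd p))"]) auto
  also have "\<dots> = conv \<phi> (conv \<psi> \<xi>) (qM I)"
    unfolding conv_qM[OF I] split_def
    by (rule sum.cong) (use I in \<open>auto simp: conv_qM sum_distrib_left split_def mult.assoc\<close>)
  finally show "conv (conv \<phi> \<psi>) \<xi> (qM I) = conv \<phi> (conv \<psi> \<xi>) (qM I)" .
qed auto

lemma conv_add_left: "conv (\<phi> + \<psi>) \<xi> = conv \<phi> \<xi> + conv \<psi> \<xi>"
  by (rule dual_eqI) (auto simp: conv_qM_take_drop algebra_simps sum.distrib)

lemma conv_add_right: "conv \<xi> (\<phi> + \<psi>) = conv \<xi> \<phi> + conv \<xi> \<psi>"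
  by (rule dual_eqI) (auto simp: conv_qM_take_drop algebra_simps sum.distrib)

lemma conv_diff_left: "conv (\<phi> - \<psi>) \<xi> = conv \<phi> \<xi> - conv \<psi> \<xi>"
  by (rule dual_eqI) (auto simp: conv_qM_take_drop algebra_simps sum_subtractf)

lemma conv_diff_right: "conv \<xi> (\<phi> - \<psi>) = conv \<xi> \<phi> - conv \<xi> \<psi>"
  by (rule dual_eqI) (auto simp: conv_qM_take_drop algebra_simps sum_subtractf)

lemma conv_fscale_left: "conv (fscale c \<phi>) \<psi> = fscale c (conv \<phi> \<psi>)"
  by (rule dual_eqI) (auto simp: conv_qM_take_drop fscale_apply sum_distrib_left mult.assoc)

lemma conv_fscale_right: "conv \<phi> (fscale c \<psi>) = fscale c (conv \<phi> \<psi>)"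
  by (rule dual_eqI) (auto simp: conv_qM_take_drop fscale_apply sum_distrib_left
      mult.left_commute)

section \<open>Functionals depending on the length\<close>

text \<open>Let u be 1 on the M_I of length 1 and 0 on the others. Its convolution power u^r is the
  indicator of length r, so this is g(u). As \<zeta> = 1 + u, inverses and logarithms become
  computations in one variable.\<close>

definition length_functional :: "rat fps \<Rightarrow> 'l::finite qsym \<Rightarrow> rat" where
  "length_functional g = mext (*) (\<lambda>I. fps_nth g (length I))"

lemma dual_length_functional [simp, intro]: "dual (length_functional g)"
  by (simp add: length_functional_def)

lemma length_functional_qM [simp]:
  "I \<in> compositions \<Longrightarrow> length_functional g (qM I) = fps_nth g (length I)"
  by (simp add: length_functional_def)

text \<open>A cut after r of m parts leaves lengths r and m - r, which is the Cauchy
  product.\<close>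

lemma conv_length_functional:
  "conv (length_functional g) (length_functional h) = length_functional (g * h)"
  by (rule dual_eqI)
    (auto simp: conv_qM_take_drop take_drop_composition fps_mult_nth atLeast0AtMost min_def
      intro!: sum.cong)

lemma counit_eq_length_functional: "counit = length_functional 1"
  by (simp add: counit_def length_functional_def)

lemma zeta_eq_length_functional: "zeta = length_functional (1 + fps_X)"
  unfolding zeta_def length_functional_def
  by (rule arg_cong[where f = "mext (*)"]) (auto simp: fun_eq_iff le_Suc_eq)

lemma dual_counit [simp, intro]: "dual counit"
  by (simp add: counit_def)

lemma counit_qM: "I \<in> compositions \<Longrightarrow> counit (qM I) = (if I = [] then 1 else 0)"
  by (simp add: counit_def)

lemma conv_counit_left: "dual \<phi> \<Longrightarrow> conv counit \<phi> = \<phi>"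
proof (rule dual_eqI)
  fix I :: "(nat ^ 'a) list" assume I: "I \<in> compositions"
  have "conv counit \<phi> (qM I) = (\<Sum>r\<le>length I. if r = 0 then \<phi> (qM I) else 0)"
    unfolding conv_qM_take_drop[OF I]
    by (rule sum.cong) (auto simp: counit_qM take_drop_composition I)
  then show "conv counit \<phi> (qM I) = \<phi> (qM I)" by simp
qed auto

lemma conv_counit_right: "dual \<phi> \<Longrightarrow> conv \<phi> counit = \<phi>"
proof (rule dual_eqI)
  fix I :: "(nat ^ 'a) list" assume I: "I \<in> compositions"
  have "conv \<phi> counit (qM I) = (\<Sum>r\<le>length I. if r = length I then \<phi> (qM I) else 0)"
    unfolding conv_qM_take_drop[OF I]
    by (rule sum.cong) (auto simp: counit_qM take_drop_composition I)
  then show "conv \<phi> counit (qM I) = \<phi> (qM I)" by simp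
qed auto

lemma zeta_inv_eq_length_functional:
  "(zeta_inv :: 'l::finite qsym \<Rightarrow> rat) = length_functional (inverse (1 + fps_X))"
  unfolding zeta_inv_def
proof (rule the_equality)
  let ?L = "length_functional (inverse (1 + fps_X)) :: 'l qsym \<Rightarrow> rat"
  have "inverse (1 + fps_X) * (1 + fps_X :: rat fps) = 1"
    by (rule inverse_mult_eq_1) simp
  then show *: "dual ?L \<and> conv zeta ?L = counit \<and> conv ?L zeta = counit"
    by (simp add: zeta_eq_length_functional conv_length_functional counit_eq_length_functional
        mult.commute)
  fix \<psi> :: "'l qsym \<Rightarrow> rat"
  assume \<psi>: "dual \<psi> \<and> conv zeta \<psi> = counit \<and> conv \<psi> zeta = counit"
  \<comment> \<open>Since \<open>?L\<close> is a right inverse of \<zeta>, any left inverse \<psi>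
    equals \<psi> (\<zeta> L) = (\<psi> \<zeta>) L = L.\<close>
  have "\<psi> = conv (conv \<psi> zeta) ?L"
    using * \<psi> by (subst conv_assoc) (simp add: conv_counit_right)
  then show "\<psi> = ?L"
    using \<psi> by (simp add: conv_counit_left)
qed

section \<open>The ring of noncommutative symmetric functions\<close>

lemma NSym_simps [simp]:
  "monoid.mult NSym = conv" "monoid.one NSym = counit" "ring.zero NSym = 0" "ring.add NSym = (+)"
  by (simp_all add: NSym_def)

lemma qM_homog: "I \<in> compositions \<Longrightarrow> qM I \<in> homog (sum_list I)"
  unfolding homog_def by (auto intro: qs.span_base)

text \<open>Each degree has only finitely many compositions, so a functional living in finitely many
  degrees is nonzero on finitely many M_I. Closure under convolution is checked in this
  form.\<close>

lemma NSym_carrier_iff: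
  "\<phi> \<in> carrier NSym \<longleftrightarrow> dual \<phi> \<and> finite {I \<in> compositions. \<phi> (qM I) \<noteq> 0}"
proof -
  let ?S = "{I \<in> compositions. \<phi> (qM I) \<noteq> 0}"
  have "{n. \<exists>h\<in>homog n. \<phi> h \<noteq> 0} = sum_list ` ?S" if \<phi>: "dual \<phi>"
  proof safe
    fix n h assume h: "h \<in> homog n" "\<phi> h \<noteq> 0"
    then have "\<exists>I\<in>compositions. sum_list I = n \<and> \<phi> (qM I) \<noteq> 0"
      using dual_span_eq_0[OF \<phi>, of "qM ` {I \<in> compositions. sum_list I = n}" h]
      unfolding homog_def by blast
    then show "n \<in> sum_list ` ?S" by blast
  next
    fix I :: "(nat ^ 'a) list" assume "I \<in> compositions" "\<phi> (qM I) \<noteq> 0"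
    then show "\<exists>h\<in>homog (sum_list I). \<phi> h \<noteq> 0" using qM_homog by blast
  qed
  moreover have "finite (sum_list ` ?S) \<longleftrightarrow> finite ?S"
  proof
    assume "finite (sum_list ` ?S)"
    then have "finite (\<Union>n\<in>sum_list ` ?S. {I \<in> compositions. sum_list I = n})"
      by (rule finite_UN_I) (rule finite_compositions_of)
    then show "finite ?S" by (rule finite_subset[rotated]) auto
  qed simp
  ultimately show ?thesis by (auto simp: NSym_def)
qed

lemma NSym_dual: "\<phi> \<in> carrier NSym \<Longrightarrow> dual \<phi>"
  by (simp add: NSym_carrier_iff)

lemma NSym_add: "\<phi> \<in> carrier NSym \<Longrightarrow> \<psi> \<in> carrier NSym \<Longrightarrow> \<phi> + \<psi> \<in> carrier NSym"
  unfolding NSym_carrier_iff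
  by (auto intro: finite_subset[OF _ finite_UnI[of "{I \<in> compositions. \<phi> (qM I) \<noteq> 0}"
          "{I \<in> compositions. \<psi> (qM I) \<noteq> 0}"]])

lemma NSym_fscale: "\<phi> \<in> carrier NSym \<Longrightarrow> fscale c \<phi> \<in> carrier NSym"
  unfolding NSym_carrier_iff
  by (auto simp: fscale_apply intro: finite_subset[of _ "{I \<in> compositions. \<phi> (qM I) \<noteq> 0}"])

lemma NSym_zero: "0 \<in> carrier NSym"
  by (simp add: NSym_carrier_iff)

lemma NSym_counit: "counit \<in> carrier NSym"
  unfolding NSym_carrier_iff
  by (rule conjI[OF dual_counit finite_subset[of _ "{[]}"]]) (auto simp: counit_qM split: if_splits)

lemma NSym_conv:
  assumes "\<phi> \<in> carrier NSym" "\<psi> \<in> carrier NSym"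
  shows "conv \<phi> \<psi> \<in> carrier NSym"
proof -
  let ?S = "\<lambda>\<phi>. {I \<in> compositions. \<phi> (qM I) \<noteq> 0}"
  have "?S (conv \<phi> \<psi>) \<subseteq> (\<lambda>(J, K). J @ K) ` (?S \<phi> \<times> ?S \<psi>)"
  proof
    fix I assume I: "I \<in> ?S (conv \<phi> \<psi>)"
    then have c: "I \<in> compositions" by simp
    from I obtain r where r: "\<phi> (qM (take r I)) * \<psi> (qM (drop r I)) \<noteq> 0"
      by (force simp: conv_qM_take_drop dest: sum.not_neutral_contains_not_neutral)
    then show "I \<in> (\<lambda>(J, K). J @ K) ` (?S \<phi> \<times> ?S \<psi>)"
      by (intro image_eqI[of _ _ "(take r I, drop r I)"]) (auto simp: take_drop_composition c)
  qed
  then show ?thesis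
    using assms finite_subset unfolding NSym_carrier_iff by blast
qed

lemma NSym_uminus: "\<phi> \<in> carrier NSym \<Longrightarrow> - \<phi> \<in> carrier NSym"
  using NSym_fscale[of \<phi> "-1"] by (simp add: fscale_def fun_Compl_def)

lemma NSym_diff: "\<phi> \<in> carrier NSym \<Longrightarrow> \<psi> \<in> carrier NSym \<Longrightarrow> \<phi> - \<psi> \<in> carrier NSym"
  using NSym_add[OF _ NSym_uminus, of \<phi> \<psi>] by simp

lemma NSym_sum: "(\<And>x. x \<in> A \<Longrightarrow> \<phi> x \<in> carrier NSym) \<Longrightarrow> (\<Sum>x\<in>A. \<phi> x) \<in> carrier NSym"
  by (induction A rule: infinite_finite_induct) (auto intro: NSym_add NSym_zero)

lemma ring_NSym: "ring (NSym :: ('l::finite qsym \<Rightarrow> rat) ring)"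
proof (rule ringI)
  show "abelian_group (NSym :: ('l::finite qsym \<Rightarrow> rat) ring)"
  proof (rule abelian_groupI)
    fix \<phi> :: "'l qsym \<Rightarrow> rat" assume "\<phi> \<in> carrier NSym"
    then show "\<exists>y\<in>carrier NSym. y \<oplus>\<^bsub>NSym\<^esub> \<phi> = \<zero>\<^bsub>NSym\<^esub>"
      by (intro bexI[of _ "- \<phi>"]) (auto intro: NSym_uminus)
  qed (auto simp: NSym_add NSym_zero algebra_simps)
  show "monoid (NSym :: ('l::finite qsym \<Rightarrow> rat) ring)"
    by (rule monoidI)
      (auto simp: NSym_conv NSym_counit conv_assoc conv_counit_left conv_counit_right NSym_dual)
qed (auto simp: conv_add_left conv_add_right)

section \<open>Two-sided ideals of NSym\<close>

context
  fixes J :: "('l::finite qsym \<Rightarrow> rat) set"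
  assumes J: "ideal J NSym"
begin

interpretation ideal J NSym by (rule J)

lemma NSym_ideal_subset: "\<phi> \<in> J \<Longrightarrow> \<phi> \<in> carrier NSym"
  by (rule Icarr)

lemma NSym_ideal_0: "0 \<in> J"
  using additive_subgroup.zero_closed[OF is_additive_subgroup] by simp

lemma NSym_ideal_add: "\<phi> \<in> J \<Longrightarrow> \<psi> \<in> J \<Longrightarrow> \<phi> + \<psi> \<in> J"
  using additive_subgroup.a_closed[OF is_additive_subgroup] by simp

lemma NSym_ideal_conv_left: "\<phi> \<in> J \<Longrightarrow> \<psi> \<in> carrier NSym \<Longrightarrow> conv \<psi> \<phi> \<in> J"
  using I_l_closed by simp

lemma NSym_ideal_conv_right: "\<phi> \<in> J \<Longrightarrow> \<psi> \<in> carrier NSym \<Longrightarrow> conv \<phi> \<psi> \<in> J"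
  using I_r_closed by simp

text \<open>Multiplication by c is convolution with c times the counit, an element of the
  ring.\<close>

lemma NSym_ideal_fscale:
  assumes "\<phi> \<in> J" shows "fscale c \<phi> \<in> J"
proof -
  have "fscale c \<phi> = conv (fscale c counit) \<phi>"
    using assms by (simp add: conv_fscale_left conv_counit_left NSym_dual NSym_ideal_subset)
  then show ?thesis using assms by (simp add: NSym_ideal_conv_left NSym_fscale NSym_counit)
qed

lemma NSym_ideal_diff: "\<phi> \<in> J \<Longrightarrow> \<psi> \<in> J \<Longrightarrow> \<phi> - \<psi> \<in> J"
  using NSym_ideal_add[OF _ NSym_ideal_fscale[of \<psi> "-1"], of \<phi>]
  by (simp add: fscale_def fun_diff_def plus_fun_def)

lemma NSym_ideal_sum: "(\<And>x. x \<in> A \<Longrightarrow> \<phi> x \<in> J) \<Longrightarrow> (\<Sum>x\<in>A. \<phi> x) \<in> J"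
  by (induction A rule: infinite_finite_induct) (auto intro: NSym_ideal_add NSym_ideal_0)

text \<open>The mixed term \<open>conv \<phi>' \<psi>\<close> is inserted; this choice decides which
  two functionals have to lie in the carrier.\<close>

lemma NSym_ideal_conv_diff:
  assumes "\<phi> - \<phi>' \<in> J" "\<psi> - \<psi>' \<in> J" "\<phi>' \<in> carrier NSym" "\<psi> \<in> carrier NSym"
  shows "conv \<phi> \<psi> - conv \<phi>' \<psi>' \<in> J"
proof -
  have "conv \<phi> \<psi> - conv \<phi>' \<psi>' = conv (\<phi> - \<phi>') \<psi> + conv \<phi>' (\<psi> - \<psi>')"
    by (simp add: conv_diff_left conv_diff_right)
  then show ?thesis
    using assms by (simp add: NSym_ideal_add NSym_ideal_conv_left NSym_ideal_conv_right)
qed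

end

section \<open>Series with homogeneous coefficients\<close>

text \<open>The degree n part of \<open>length_functional g\<close>; equally, the coefficient of t^n
  in g(F), where F is the sum of the S_m t^m with m nonzero.\<close>

definition length_series :: "rat fps \<Rightarrow> nat ^ 'l::finite \<Rightarrow> 'l qsym \<Rightarrow> rat" where
  "length_series g n = mext (*) (\<lambda>I. if sum_list I = n then fps_nth g (length I) else 0)"

lemma dual_length_series [simp, intro]: "dual (length_series g n)"
  by (simp add: length_series_def)

lemma length_series_qM [simp]:
  "I \<in> compositions \<Longrightarrow>
    length_series g n (qM I) = (if sum_list I = n then fps_nth g (length I) else 0)"
  by (simp add: length_series_def)

lemma NSym_length_series [simp]: "length_series g n \<in> carrier NSym"
  unfolding NSym_carrier_iff
  by (intro conjI finite_subset[OF _ finite_compositions_of[of n]]) (auto split: if_splits)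

lemma length_series_0: "fps_nth g 0 = 0 \<Longrightarrow> length_series g 0 = 0"
  by (rule dual_eqI) (auto simp: composition_sum_eq_0)

lemma ser_mult_length_series:
  "ser_mult (length_series g) (length_series h) = length_series (g * h)"
proof
  fix n :: "nat ^ 'a"
  show "ser_mult (length_series g) (length_series h) n = length_series (g * h) n"
  proof (rule dual_eqI)
    fix I :: "(nat ^ 'a) list" assume I: "I \<in> compositions"
    let ?D = "{p. fst p + snd p = n}"
    have fin: "finite ?D" using finite_nat_vec_add[of n] by (simp add: split_def)
    let ?c = "\<lambda>r. fps_nth g r * fps_nth h (length I - r)"
    \<comment> \<open>A cut of I determines the degrees of its two blocks, so each cut meets at most
      one pair of degrees with sum n.\<close>
    have "ser_mult (length_series g) (length_series h) n (qM I) =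
        (\<Sum>p\<in>?D. \<Sum>r\<le>length I. if p = (sum_list (take r I), sum_list (drop r I)) then ?c r else 0)"
      unfolding ser_mult_def sum_apply split_def conv_qM_take_drop[OF I]
      by (intro sum.cong) (auto simp: I take_drop_composition min_def prod_eq_iff)
    also have "\<dots> = (\<Sum>r\<le>length I. if sum_list (take r I) + sum_list (drop r I) = n then ?c r else 0)"
      by (subst sum.swap) (simp add: fin)
    also have "\<dots> = (if sum_list I = n then fps_nth (g * h) (length I) else 0)"
      by (simp flip: sum_list_append add: fps_mult_nth atLeast0AtMost)
    finally show "ser_mult (length_series g) (length_series h) n (qM I) = length_series (g * h) n (qM I)"
      using I by simp
  qed (auto simp: ser_mult_def split_def)
qed

lemma ser_pow_length_series: "ser_pow (length_series g) r = length_series (g ^ r)"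
proof (induction r)
  case 0
  show ?case
    by (rule ext, rule dual_eqI) (auto simp: counit_qM composition_sum_eq_0)
qed (simp add: ser_mult_length_series)

lemma ser_log1p_length_series:
  assumes "fps_nth g 0 = 0"
  shows "ser_log1p (length_series g) n = length_series (fps_compose (fps_ln 1) g) n"
proof (rule dual_eqI)
  fix I :: "(nat ^ 'a) list" assume I: "I \<in> compositions"
  let ?c = "\<lambda>r. fps_nth (fps_ln 1) r * fps_nth (g ^ r) (length I)"
  have "ser_log1p (length_series g) n (qM I) =
      (\<Sum>r = 1..weight n. if sum_list I = n then ?c r else 0)"
    unfolding ser_log1p_def sum_apply
    by (rule sum.cong) (auto simp: ser_pow_length_series fscale_def I fps_ln_nth)
  also have "\<dots> = (if sum_list I = n then \<Sum>r = 0..length I. ?c r else 0)"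
  proof -
    \<comment> \<open>The two truncations agree: g has no constant term, so g^r has no coefficient
      at the length of I once r exceeds it. The term r = 0 vanishes because log(1 + X) has no
      constant term.\<close>
    have "(\<Sum>r = 1..weight n. ?c r) = (\<Sum>r = 0..length I. ?c r)" if n: "sum_list I = n"
    proof -
      have "(\<Sum>r = 0..weight n. ?c r) = (\<Sum>r = 0..length I. ?c r)"
        by (rule sum.mono_neutral_right)
          (use length_le_weight[OF I] n startsby_zero_power_prefix[OF assms] in auto)
      moreover have "(\<Sum>r = 0..weight n. ?c r) = (\<Sum>r = 1..weight n. ?c r)"
        by (rule sum.mono_neutral_right) (auto simp: not_less_eq_eq)
      ultimately show ?thesis by simp
    qed
    then show ?thesis by auto
  qed
  finally show "ser_log1p (length_series g) n (qM I)
      = length_series (fps_compose (fps_ln 1) g) n (qM I)"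
    using I by (simp add: fps_compose_nth)
qed (auto simp: ser_log1p_def ser_pow_length_series)

text \<open>Both sides have constant term 0, and y = 1/(1 + X) satisfies y' = -y^2, so (log y)' =
  y'/y = -y. The inner series is y - 1 because \<open>fps_ln 1\<close> expands log(1 + X).\<close>

lemma fps_ln_compose_inverse:
  "fps_compose (fps_ln 1) (inverse (1 + fps_X) - 1) = - (fps_ln 1 :: rat fps)"
proof -
  let ?y = "inverse (1 + fps_X) :: rat fps"
  have y: "?y * (1 + fps_X) = 1" by (rule inverse_mult_eq_1) simp
  have iy: "inverse ?y = 1 + fps_X" by (rule fps_inverse_idempotent) simp
  have dy: "fps_deriv ?y = - ?y\<^sup>2"
    by (subst fps_inverse_deriv) (simp_all add: fps_divide_def)
  have "fps_deriv (fps_compose (fps_ln 1) (?y - 1))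
      = fps_compose (inverse (1 + fps_X)) (?y - 1) * fps_deriv ?y"
    by (subst fps_compose_deriv) (simp_all add: fps_ln_deriv)
  also have "fps_compose (inverse (1 + fps_X)) (?y - 1) = inverse (fps_compose (1 + fps_X) (?y - 1))"
    by (rule fps_inverse_compose) simp_all
  also have "fps_compose (1 + fps_X) (?y - 1) = ?y"
    by (simp add: fps_compose_add_distrib)
  also have "inverse ?y * fps_deriv ?y = - ?y"
    using y by (simp add: iy dy power2_eq_square mult.assoc[symmetric] mult.commute)
  also have "- ?y = fps_deriv (- fps_ln 1)"
    by (simp add: fps_ln_deriv)
  finally show ?thesis unfolding fps_deriv_eq_iff by simp
qed

text \<open>S_m is the indicator of the one-part composition (m), so the series under the logarithm
  is \<open>length_series fps_X\<close>. Explicitly, \<Phi>_n(M_I) = |n| (-1)^(r-1) / r for I of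
  degree n and length r > 0.\<close>

lemma nPhi_eq: "nPhi n = fscale (of_nat (weight n)) (length_series (fps_ln 1) n)"
proof -
  have "(\<lambda>m. if m = 0 then 0 else nS [m]) = (length_series fps_X :: nat ^ 'a \<Rightarrow> _)"
  proof
    fix m :: "nat ^ 'a"
    show "(if m = 0 then 0 else nS [m]) = length_series fps_X m"
    proof (cases "m = 0")
      case False
      have "nS [m] = length_series fps_X m"
      proof (rule dual_eqI)
        fix I :: "(nat ^ 'a) list" assume "I \<in> compositions"
        then show "nS [m] (qM I) = length_series fps_X m (qM I)"
          by (cases I; cases "tl I") (auto simp: nS_def fps_X_def)
      qed (auto simp: nS_def)
      with False show ?thesis by simp
    qed (simp add: length_series_0)
  qed
  then show ?thesis by (simp add: nPhi_def ser_log1p_length_series)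
qed

section \<open>The odd ideal\<close>

lemma linear_hcomp: "Vector_Spaces.linear qscale qscale (hcomp n)"
  unfolding hcomp_def by (rule mext_linear) (rule vector_space_qscale)

lemma hcomp_add: "hcomp n (f + g) = hcomp n f + hcomp n g"
  using linear_hcomp[of n] by (simp add: linear_iff_module_hom module_hom_iff)

lemma hcomp_scale: "hcomp n (qscale c f) = qscale c (hcomp n f)"
  using linear_hcomp[of n] by (simp add: linear_iff_module_hom module_hom_iff)

lemma hcomp_0: "hcomp n 0 = 0"
  using hcomp_scale[of n 0 0] by simp

lemma hcomp_qM: "I \<in> compositions \<Longrightarrow> hcomp n (qM I) = (if sum_list I = n then qM I else 0)"
  unfolding hcomp_def by (simp add: mext_qM vector_space_qscale)

lemma hcomp_homog:
  assumes "f \<in> homog m"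
  shows "hcomp n f = (if m = n then f else 0)"
  using assms unfolding homog_def
  by (induction rule: qs.span_induct_alt) (auto simp: hcomp_0 hcomp_add hcomp_scale hcomp_qM)

lemma hcomp_in_homog: "hcomp n f \<in> homog n"
proof -
  have "f \<in> qs.span (qM ` compositions)" by (rule span_qM)
  then show ?thesis
  proof (induction rule: qs.span_induct_alt)
    case base
    then show ?case by (simp add: hcomp_0 homog_def qs.span_zero)
  next
    case (step c x y)
    then have "hcomp n x \<in> homog n"
      by (auto simp: hcomp_qM qM_homog) (simp add: homog_def qs.span_zero)
    with step show ?case
      unfolding hcomp_add hcomp_scale homog_def by (intro qs.span_add qs.span_scale)
  qed
qed

lemma dual_deg_part: "dual \<phi> \<Longrightarrow> dual (deg_part n \<phi>)"
  by (simp add: dual_iff deg_part_def hcomp_add hcomp_scale)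

lemma deg_part_qM:
  "dual \<phi> \<Longrightarrow> I \<in> compositions \<Longrightarrow> deg_part n \<phi> (qM I) = (if sum_list I = n then \<phi> (qM I) else 0)"
  by (simp add: deg_part_def hcomp_qM dual_0)

text \<open>The positive-degree parts of the character with signs and of the convolution inverse.\<close>

definition bar_series :: "nat ^ 'l::finite \<Rightarrow> 'l qsym \<Rightarrow> rat" where
  "bar_series n = fscale ((-1) ^ weight n) (length_series fps_X n)"

definition inv_series :: "nat ^ 'l::finite \<Rightarrow> 'l qsym \<Rightarrow> rat" where
  "inv_series = length_series (inverse (1 + fps_X) - 1)"

lemma dual_zeta_bar [simp]: "dual zeta_bar"
  by (simp add: zeta_bar_def)

lemma dual_zeta_inv [simp]: "dual zeta_inv"
  by (simp add: zeta_inv_eq_length_functional)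

text \<open>Both characters are 1 on M_(), so their constant terms cancel and series without
  constant term suffice.\<close>

lemma odd_generator_eq:
  "deg_part n zeta_bar - deg_part n zeta_inv = bar_series n - inv_series n"
proof (rule dual_eqI)
  fix I :: "(nat ^ 'a) list" assume I: "I \<in> compositions"
  show "(deg_part n zeta_bar - deg_part n zeta_inv) (qM I) = (bar_series n - inv_series n) (qM I)"
    using I unfolding bar_series_def inv_series_def
    by (cases I)
      (auto simp: deg_part_qM zeta_inv_eq_length_functional zeta_bar_def zeta_eq_length_functional
        fscale_apply)
qed (auto simp: bar_series_def inv_series_def intro!: dual_minus dual_deg_part)

section \<open>Logarithms of the two series\<close>

lemma ser_pow_sign_twist:
  "ser_pow (\<lambda>m. fscale ((-1) ^ weight m) (F m)) r n = fscale ((-1) ^ weight n) (ser_pow F r n)"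
proof (induction r arbitrary: n)
  case (Suc r)
  \<comment> \<open>The sign is multiplicative in t^n because the weight is additive: the twist
    substitutes -t_i for t_i.\<close>
  show ?case
    unfolding ser_pow.simps ser_mult_def split_def Suc fs.scale_sum_right
    by (rule sum.cong)
      (auto simp: conv_fscale_left conv_fscale_right weight_add power_add mult.commute)
qed simp

lemma ser_log1p_sign_twist:
  "ser_log1p (\<lambda>m. fscale ((-1) ^ weight m) (F m)) n = fscale ((-1) ^ weight n) (ser_log1p F n)"
  unfolding ser_log1p_def ser_pow_sign_twist fs.scale_sum_right
  by (rule sum.cong) (auto simp: mult.commute)

text \<open>The sign twist yields the first summand of the factor, log(1/y) = -log y the second; the
  factor is 2 in even weight and 0 in odd weight.\<close>

lemma log_bar_minus_log_inv:
  "ser_log1p bar_series n - ser_log1p inv_series n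
    = fscale ((-1) ^ weight n + 1) (length_series (fps_ln 1) n)"
proof -
  have "ser_log1p bar_series n = fscale ((-1) ^ weight n) (length_series (fps_ln 1) n)"
    by (simp add: bar_series_def[abs_def] ser_log1p_sign_twist ser_log1p_length_series)
  moreover have "ser_log1p inv_series n = fscale (-1) (length_series (fps_ln 1) n)"
  proof -
    have "ser_log1p inv_series n = length_series (- fps_ln 1) n"
      by (simp add: inv_series_def ser_log1p_length_series fps_ln_compose_inverse)
    also have "\<dots> = fscale (-1) (length_series (fps_ln 1) n)"
      by (rule dual_eqI) (auto simp: fscale_apply)
    finally show ?thesis .
  qed
  ultimately show ?thesis by (simp add: fs.scale_left_distrib)
qed

lemma NSym_bar_series [simp]: "bar_series n \<in> carrier NSym"
  by (simp add: bar_series_def NSym_fscale)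

lemma NSym_inv_series [simp]: "inv_series n \<in> carrier NSym"
  by (simp add: inv_series_def)

lemma bar_series_0: "bar_series 0 = 0"
  by (simp add: bar_series_def length_series_0)

lemma inv_series_0: "inv_series 0 = 0"
  by (simp add: inv_series_def length_series_0)

section \<open>Congruence of powers and logarithms modulo an ideal\<close>

lemma NSym_ser_pow: "(\<And>m. F m \<in> carrier NSym) \<Longrightarrow> ser_pow F r n \<in> carrier NSym"
  by (induction r arbitrary: n)
    (auto simp: ser_mult_def split_def NSym_zero NSym_counit intro!: NSym_sum NSym_conv)

lemma ser_pow_1: "(\<And>m. dual (F m)) \<Longrightarrow> ser_pow F (Suc 0) n = F n"
proof -
  assume F: "\<And>m. dual (F m)"
  \<comment> \<open>The zeroth power lives in degree 0, so only the splitting n + 0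
    contributes.\<close>
  have "ser_pow F (Suc 0) n = (\<Sum>p\<in>{(a, b). a + b = n}. if p = (n, 0) then F n else 0)"
    unfolding ser_pow.simps ser_mult_def
    by (rule sum.cong) (auto simp: conv_counit_right F)
  also have "\<dots> = F n" by (simp add: finite_nat_vec_add)
  finally show ?thesis .
qed

lemma ser_pow_diff_in_ideal:
  assumes "ideal J NSym" "\<And>m. F m \<in> carrier NSym" "\<And>m. G m \<in> carrier NSym"
    and "\<And>m. m \<le> n \<Longrightarrow> F m - G m \<in> J"
  shows "ser_pow F r n - ser_pow G r n \<in> J"
  using assms(4)
proof (induction r arbitrary: n)
  case (Suc r)
  have "conv (F a) (ser_pow F r b) - conv (G a) (ser_pow G r b) \<in> J" if "a + b = n" for a b
  proof (rule NSym_ideal_conv_diff[OF assms(1)])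
    show "F a - G a \<in> J" using Suc.prems that nat_vec_add_le by metis
    show "ser_pow F r b - ser_pow G r b \<in> J"
      using Suc that nat_vec_add_le by (metis order_trans)
  qed (auto intro: assms NSym_ser_pow)
  then show ?case
    unfolding ser_pow.simps ser_mult_def split_def sum_subtractf[symmetric]
    by (intro NSym_ideal_sum[OF assms(1)]) auto
qed (simp add: NSym_ideal_0 assms(1))

text \<open>Without constant terms, a product of at least two factors in degree n uses only parts of
  degree strictly below n. That the hypothesis stops short of n makes the later induction
  possible.\<close>

lemma ser_pow_ge_2_diff_in_ideal:
  assumes "ideal J NSym" "\<And>m. F m \<in> carrier NSym" "\<And>m. G m \<in> carrier NSym"
    and "F 0 = 0" "G 0 = 0" "2 \<le> r" and *: "\<And>m. m < n \<Longrightarrow> F m - G m \<in> J"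
  shows "ser_pow F r n - ser_pow G r n \<in> J"
proof -
  obtain s where s: "r = Suc s" "s > 0" using assms(6) by (cases r) auto
  have "conv (F a) (ser_pow F s b) - conv (G a) (ser_pow G s b) \<in> J" if n: "a + b = n" for a b
  proof (cases "a = 0 \<or> b = 0")
    case True
    \<comment> \<open>As s > 0, these powers have no constant term either; this settles b =
      0.\<close>
    have "ser_pow F s 0 = 0" "ser_pow G s 0 = 0"
      using s by (auto intro: ser_pow_eq_0 assms)
    then show ?thesis using True assms by (auto simp: NSym_ideal_0)
  next
    case False
    have "a < n" "b < n"
      using nat_vec_add_le[of a b] nat_vec_add_le[of b a] False n
      by (auto simp: order.strict_iff_order)
    then show ?thesis
      by (intro NSym_ideal_conv_diff[OF assms(1)] ser_pow_diff_in_ideal * NSym_ser_pow assms) auto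
  qed
  then show ?thesis
    unfolding s(1) ser_pow.simps ser_mult_def split_def sum_subtractf[symmetric]
    by (intro NSym_ideal_sum[OF assms(1)]) auto
qed

lemma ser_log1p_diff:
  "ser_log1p F n - ser_log1p G n =
    (\<Sum>r = 1..weight n. fscale ((-1) ^ (r - 1) / of_nat r) (ser_pow F r n - ser_pow G r n))"
  by (simp add: ser_log1p_def sum_subtractf fs.scale_right_diff_distrib)

text \<open>The ideal is arbitrary so that the result serves both generated ideals and annihilators.
  Forwards, congruent series have congruent logarithms; backwards, each coefficient is recovered
  from the logarithm and from lower degrees.\<close>

lemma odd_generators_iff_even_nPhi:
  assumes J: "ideal J NSym"
  shows "(\<forall>n. evec n \<le> k \<longrightarrow> bar_series n - inv_series n \<in> J) \<longleftrightarrow>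
    (\<forall>n. 0 < n \<and> evec n \<le> k \<and> even (weight n) \<longrightarrow> nPhi n \<in> J)"
proof (intro iffI allI impI)
  fix n assume *: "\<forall>n. evec n \<le> k \<longrightarrow> bar_series n - inv_series n \<in> J"
    and n: "0 < n \<and> evec n \<le> k \<and> even (weight n)"
  have "ser_log1p bar_series n - ser_log1p inv_series n \<in> J"
    unfolding ser_log1p_diff using * n
    by (intro NSym_ideal_sum[OF J] NSym_ideal_fscale[OF J] ser_pow_diff_in_ideal[OF J])
      (auto intro: evec_mono)
  \<comment> \<open>In even weight the difference of logarithms is 2 \<Phi>_n / |n|, and this factor
    restores \<Phi>_n.\<close>
  then have "fscale (of_nat (weight n) / 2) (ser_log1p bar_series n - ser_log1p inv_series n) \<in> J"
    by (rule NSym_ideal_fscale[OF J])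
  then show "nPhi n \<in> J"
    using n by (simp add: log_bar_minus_log_inv nPhi_eq)
next
  fix n assume *: "\<forall>n. 0 < n \<and> evec n \<le> k \<and> even (weight n) \<longrightarrow> nPhi n \<in> J"
    and n: "evec n \<le> k"
  show "bar_series n - inv_series n \<in> J"
    using n
  proof (induction "weight n" arbitrary: n rule: less_induct)
    case less
    show ?case
    proof (cases "n = 0")
      case True
      then show ?thesis by (simp add: bar_series_0 inv_series_0 NSym_ideal_0[OF J])
    next
      case False
      then have w: "weight n \<noteq> 0" by (simp add: weight_eq_0_iff)
      let ?d = "\<lambda>r. fscale ((-1) ^ (r - 1) / of_nat r)
        (ser_pow bar_series r n - ser_pow inv_series r n)"
      have log: "ser_log1p bar_series n - ser_log1p inv_series n \<in> J"
      proof (cases "even (weight n)")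
        case True
        with * less.prems False have "nPhi n \<in> J" by simp
        then have "fscale (2 / of_nat (weight n)) (nPhi n) \<in> J"
          by (rule NSym_ideal_fscale[OF J])
        then show ?thesis using w True by (simp add: log_bar_minus_log_inv nPhi_eq)
      qed (simp add: log_bar_minus_log_inv NSym_ideal_0[OF J])
      have tail: "(\<Sum>r = 2..weight n. ?d r) \<in> J"
      proof (intro NSym_ideal_sum[OF J] NSym_ideal_fscale[OF J] ser_pow_ge_2_diff_in_ideal[OF J])
        fix m assume "m < n"
        then show "bar_series m - inv_series m \<in> J"
          using less by (meson evec_mono order_less_imp_le vec_less_imp_weight_less)
      qed (auto simp: bar_series_0 inv_series_0)
      \<comment> \<open>The term r = 1 of a logarithm is the coefficient itself; all later terms are
        in J by induction.\<close>
      have "ser_log1p bar_series n - ser_log1p inv_series n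
          = (bar_series n - inv_series n) + (\<Sum>r = 2..weight n. ?d r)"
      proof -
        have "(\<Sum>r = 1..weight n. ?d r) = ?d 1 + (\<Sum>r = 2..weight n. ?d r)"
          using w by (subst sum.atLeast_Suc_atMost) (auto simp: numeral_2_eq_2)
        then show ?thesis by (simp add: ser_log1p_diff ser_pow_1 NSym_dual del: ser_pow.simps)
      qed
      with NSym_ideal_diff[OF J log tail] show ?thesis by simp
    qed
  qed
qed

lemma NSym_nPhi [simp]: "nPhi n \<in> carrier NSym"
  by (simp add: nPhi_eq NSym_fscale)

text \<open>An ideal containing one generating family contains the other; applied to both generated
  ideals, this gives the two inclusions by minimality.\<close>

lemma odd_ideal_eq:
  "odd_ideal k = genideal NSym {nPhi n | n. 0 < n \<and> evec n \<le> k \<and> even (weight n)}"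
    (is "_ = genideal NSym ?P")
proof -
  interpret ring "NSym :: ('a qsym \<Rightarrow> rat) ring" by (rule ring_NSym)
  let ?X = "{bar_series n - inv_series n | n. evec n \<le> k}"
  have X: "odd_ideal k = genideal NSym ?X"
    by (simp add: odd_ideal_def odd_generator_eq)
  have iX: "ideal (genideal NSym ?X) NSym" "?X \<subseteq> genideal NSym ?X"
    by (rule genideal_ideal genideal_self; auto intro: NSym_diff)+
  have iP: "ideal (genideal NSym ?P) NSym" "?P \<subseteq> genideal NSym ?P"
    by (rule genideal_ideal genideal_self; auto)+
  show ?thesis unfolding X
  proof
    show "genideal NSym ?X \<subseteq> genideal NSym ?P"
      using odd_generators_iff_even_nPhi[OF iP(1), of k] iP
      by (intro genideal_minimal) auto
    show "genideal NSym ?P \<subseteq> genideal NSym ?X"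
      using odd_generators_iff_even_nPhi[OF iX(1), of k] iX
      by (intro genideal_minimal) auto
  qed
qed

section \<open>The dual basis of the power sums\<close>

lemma nPhi_prod_Nil [simp]: "nPhi_prod [] = counit"
  and nPhi_prod_Cons [simp]: "nPhi_prod (n # I) = conv (nPhi n) (nPhi_prod I)"
  by (simp_all add: nPhi_prod_def)

lemma NSym_nPhi_prod [simp]: "nPhi_prod I \<in> carrier NSym"
  by (induction I) (auto intro: NSym_counit NSym_conv)

lemma dual_nPhi_prod [simp]: "dual (nPhi_prod I)"
  by (simp add: NSym_dual)

lemma nPhi_prod_append: "nPhi_prod (I @ J) = conv (nPhi_prod I) (nPhi_prod J)"
  by (induction I) (auto simp: conv_counit_left conv_assoc)

section \<open>Triangularity of \<Phi>^J(M_I) with respect to length\<close>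

lemma nPhi_qM:
  "I \<in> compositions \<Longrightarrow> nPhi n (qM I) =
    (if sum_list I = n then of_nat (weight n) * fps_nth (fps_ln 1) (length I) else 0)"
  by (simp add: nPhi_eq fscale_apply)

text \<open>In a nonzero term the factors cut I into consecutive nonempty blocks whose sums are the
  entries of J. So J arises by adding up blocks of I: it is I itself or shorter.\<close>

lemma nPhi_prod_qM_nonzero:
  assumes "I \<in> compositions" "nPhi_prod J (qM I) \<noteq> 0"
  shows "sum_list J = sum_list I \<and> (J = I \<or> length J < length I)"
  using assms
proof (induction J arbitrary: I)
  case Nil
  then show ?case by (auto simp: counit_qM split: if_splits)
next
  case (Cons n J)
  then have "(\<Sum>r\<le>length I. nPhi n (qM (take r I)) * nPhi_prod J (qM (drop r I))) \<noteq> 0"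
    by (simp add: conv_qM_take_drop)
  then obtain r where "r \<in> {..length I}" "nPhi n (qM (take r I)) * nPhi_prod J (qM (drop r I)) \<noteq> 0"
    by (rule sum.not_neutral_contains_not_neutral)
  then have r: "r \<le> length I" "nPhi n (qM (take r I)) \<noteq> 0" "nPhi_prod J (qM (drop r I)) \<noteq> 0"
    by auto
  have n: "sum_list (take r I) = n"
    using r by (auto simp: nPhi_qM take_drop_composition Cons.prems(1) split: if_splits)
  \<comment> \<open>An empty block gives 0 because log(1 + X) has no constant term.\<close>
  have r0: "r \<noteq> 0"
    using r(2) by (rule contrapos_nn) (simp add: nPhi_qM)
  have IH: "sum_list J = sum_list (drop r I) \<and> (J = drop r I \<or> length J < length (drop r I))"
    using r by (intro Cons.IH) (auto simp: take_drop_composition Cons.prems(1))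
  have "sum_list (n # J) = sum_list (take r I @ drop r I)"
    unfolding sum_list_append using n IH by simp
  moreover have "n # J = I \<or> length (n # J) < length I"
  proof (cases "r = 1 \<and> J = drop r I")
    case True
    then obtain a I' where "I = a # I'" using r(1) by (cases I) auto
    then show ?thesis using True n by simp
  next
    case False
    then have "length J \<le> length I - r" "r \<noteq> 1 \<or> length J < length I - r"
      using IH by auto
    then have "Suc (length J) < length I" using r(1) r0 by arith
    then show ?thesis by simp
  qed
  ultimately show ?case by simp
qed

text \<open>Only the cut into single parts survives. As \<Phi>_n(M_(n)) = |n|, the value is the
  product of the weights of the parts.\<close>

lemma nPhi_prod_qM_self: "I \<in> compositions \<Longrightarrow> nPhi_prod I (qM I) \<noteq> 0"
proof (induction I)
  case (Cons n I)
  have I: "n # I \<in> compositions" by fact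
  let ?t = "\<lambda>r. nPhi n (qM (take r (n # I))) * nPhi_prod I (qM (drop r (n # I)))"
  have "?t r = 0" if "r \<le> length (n # I)" "r \<noteq> 1" for r
  proof (cases "r = 0")
    case False
    \<comment> \<open>A first block of two or more parts leaves fewer parts than there are remaining
      factors.\<close>
    have "nPhi_prod I (qM (drop r (n # I))) = 0"
    proof (rule ccontr)
      assume "nPhi_prod I (qM (drop r (n # I))) \<noteq> 0"
      then have "length I \<le> length (drop r (n # I))"
        using nPhi_prod_qM_nonzero[OF take_drop_composition(2)[OF I], of I r] by fastforce
      then show False using that False by simp
    qed
    then show ?thesis by simp
  qed (simp add: nPhi_qM)
  then have "nPhi_prod (n # I) (qM (n # I)) = (\<Sum>r\<le>length (n # I). if r = 1 then ?t 1 else 0)"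
    unfolding nPhi_prod_Cons conv_qM_take_drop[OF I] by (intro sum.cong) auto
  also have "\<dots> = of_nat (weight n) * nPhi_prod I (qM I)"
    using I by (simp add: nPhi_qM fps_ln_nth Suc_le_eq)
  finally show ?case using Cons by (simp add: weight_eq_0_iff)
qed (simp add: counit_qM)

text \<open>In the row of an x of maximal size, a nonzero entry off the diagonal would need a column
  of larger size, so only \<open>c x * A x x\<close> remains.\<close>

lemma triangular_separation:
  fixes c :: "'a \<Rightarrow> rat" and A :: "'a \<Rightarrow> 'a \<Rightarrow> rat" and size :: "'a \<Rightarrow> nat"
  assumes "finite S" "S \<noteq> {}" "\<And>x. x \<in> S \<Longrightarrow> c x \<noteq> 0" "\<And>x. x \<in> S \<Longrightarrow> A x x \<noteq> 0"
    and "\<And>x y. x \<in> S \<Longrightarrow> y \<in> S \<Longrightarrow> A x y \<noteq> 0 \<Longrightarrow> x = y \<or> size x < size y"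
  shows "\<exists>x\<in>S. (\<Sum>y\<in>S. c y * A x y) \<noteq> 0"
proof -
  have fin: "finite (size ` S)" "size ` S \<noteq> {}" using assms(1,2) by auto
  obtain x where x: "x \<in> S" "size x = Max (size ` S)" using Max_in[OF fin] by auto
  have "A x y = 0" if "y \<in> S" "y \<noteq> x" for y
    using assms(5)[OF x(1) that(1)] that(2) Max_ge[OF fin(1), of "size y"] that(1) x(2) by force
  then have "(\<Sum>y\<in>S. c y * A x y) = (\<Sum>y\<in>S. if y = x then c x * A x x else 0)"
    by (intro sum.cong) auto
  also have "\<dots> \<noteq> 0" using x(1) assms by simp
  finally show ?thesis using x(1) by blast
qed

lemma nPhi_prod_separates:
  assumes "\<And>J. J \<in> compositions \<Longrightarrow> nPhi_prod J p = 0"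
  shows "p = 0"
proof (rule ccontr)
  assume "p \<noteq> 0"
  let ?S = "{I. mcoeff p I \<noteq> 0}"
  have "?S \<noteq> {}"
  proof
    assume "?S = {}"
    then have "p = 0" by (subst qsym_expansion[of p]) simp
    with \<open>p \<noteq> 0\<close> show False ..
  qed
  have "\<exists>J\<in>?S. (\<Sum>I\<in>?S. mcoeff p I * nPhi_prod J (qM I)) \<noteq> 0"
  proof (rule triangular_separation[where size = length])
    fix J I assume "J \<in> ?S" "I \<in> ?S" "nPhi_prod J (qM I) \<noteq> 0"
    then show "J = I \<or> length J < length I"
      using nPhi_prod_qM_nonzero[OF mcoeff_nonzero_composition, of p I J] by simp
  qed (use \<open>?S \<noteq> {}\<close> in \<open>auto simp: finite_mcoeff mcoeff_nonzero_composition nPhi_prod_qM_self\<close>)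
  then obtain J where "mcoeff p J \<noteq> 0" "nPhi_prod J p \<noteq> 0"
    unfolding dual_expansion[OF dual_nPhi_prod, of _ p] by blast
  then show False
    using assms mcoeff_nonzero_composition by blast
qed

section \<open>Construction of the dual basis and expansion in it\<close>

lemma homog_subspace: "qs.subspace (homog n)"
  unfolding homog_def by (rule qs.subspace_span)

text \<open>Homogeneity is carried through the induction because it later makes spans of
  \<open>qP I\<close> graded.\<close>

lemma qP_exists:
  assumes "I \<in> compositions"
  shows "\<exists>p\<in>homog (sum_list I). \<forall>J\<in>compositions. nPhi_prod J p = (if J = I then 1 else 0)"
  using assms
proof (induction "length I" arbitrary: I rule: less_induct)
  case less
  let ?S = "{J \<in> compositions. sum_list J = sum_list I \<and> length J < length I}"
  have fin: "finite ?S" by (rule finite_subset[OF _ finite_compositions_of[of "sum_list I"]]) auto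
  have "\<forall>J\<in>?S. \<exists>p. p \<in> homog (sum_list J) \<and>
      (\<forall>K\<in>compositions. nPhi_prod K p = (if K = J then 1 else 0))"
    using less.hyps by blast
  from bchoice[OF this] obtain p where *: "\<forall>J\<in>?S. p J \<in> homog (sum_list J) \<and>
      (\<forall>K\<in>compositions. nPhi_prod K (p J) = (if K = J then 1 else 0))" ..
  have p: "p J \<in> homog (sum_list J)"
      "K \<in> compositions \<Longrightarrow> nPhi_prod K (p J) = (if K = J then 1 else 0)" if "J \<in> ?S" for J K
    using bspec[OF * that] by blast+
  \<comment> \<open>Gaussian elimination along the length: \<open>\<Phi>\<^sup>J(M\<^sub>I)\<close> is triangular with nonzero diagonal.\<close>
  define q where "q = qscale (1 / nPhi_prod I (qM I)) (qM I)"
  define r where "r = q - (\<Sum>J\<in>?S. qscale (nPhi_prod J q) (p J))"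
  have "r \<in> homog (sum_list I)"
    unfolding r_def q_def
    by (intro qs.subspace_diff qs.subspace_sum qs.subspace_scale homog_subspace qM_homog less.prems)
      (use p(1) in force)
  moreover have "nPhi_prod K r = (if K = I then 1 else 0)" if K: "K \<in> compositions" for K
  proof -
    have "nPhi_prod K r = nPhi_prod K q - (\<Sum>J\<in>?S. nPhi_prod J q * (if K = J then 1 else 0))"
      unfolding r_def by (simp add: dual_diff dual_sum dual_scale p(2) K)
    also have "(\<Sum>J\<in>?S. nPhi_prod J q * (if K = J then 1 else 0)) = (if K \<in> ?S then nPhi_prod K q else 0)"
      using fin by (simp add: if_distrib cong: if_cong)
    finally have "nPhi_prod K r = (if K \<in> ?S then 0 else nPhi_prod K q)" by simp
    moreover have "nPhi_prod I q = 1"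
      unfolding q_def by (simp add: dual_scale nPhi_prod_qM_self less.prems)
    moreover have "nPhi_prod K q = 0" if "K \<notin> ?S" "K \<noteq> I"
      using nPhi_prod_qM_nonzero[OF less.prems, of K] that K
      unfolding q_def by (auto simp: dual_scale)
    ultimately show ?thesis by auto
  qed
  ultimately show ?case by blast
qed

text \<open>Existence together with separation by the \<Phi>^J justifies the definite description in
  \<open>qP\<close>.\<close>

lemma qP_spec:
  assumes I: "I \<in> compositions"
  shows qP_homog: "qP I \<in> homog (sum_list I)"
    and nPhi_prod_qP: "J \<in> compositions \<Longrightarrow> nPhi_prod J (qP I) = (if J = I then 1 else 0)"
proof -
  obtain p where p: "p \<in> homog (sum_list I)"
      "\<forall>J\<in>compositions. nPhi_prod J p = (if J = I then 1 else 0)"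
    using qP_exists[OF I] by blast
  have "qP I = p"
    unfolding qP_def
  proof (rule the_equality)
    show "\<forall>J\<in>compositions. nPhi_prod J p = (if J = I then 1 else 0)" by (rule p(2))
    fix q assume "\<forall>J\<in>compositions. nPhi_prod J q = (if J = I then 1 else 0)"
    with p(2) have "q - p = 0" by (intro nPhi_prod_separates) (simp add: dual_diff)
    then show "q = p" by simp
  qed
  with p show "qP I \<in> homog (sum_list I)"
    "J \<in> compositions \<Longrightarrow> nPhi_prod J (qP I) = (if J = I then 1 else 0)" by auto
qed

text \<open>This is the expansion of f as the sum of \<Phi>^J(f) P_J, with the vanishing terms
  dropped.\<close>

lemma in_span_qP:
  assumes "\<And>J. J \<in> compositions \<Longrightarrow> J \<notin> G \<Longrightarrow> nPhi_prod J f = 0"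
  shows "f \<in> qs.span (qP ` G)"
proof -
  let ?D = "{J \<in> compositions. nPhi_prod J f \<noteq> 0}"
  \<comment> \<open>\<Phi>^J sees only those M_I in f whose degree is that of J, so the expansion is
    finite.\<close>
  have "?D \<subseteq> (\<Union>I\<in>{I. mcoeff f I \<noteq> 0}. {J \<in> compositions. sum_list J = sum_list I})"
  proof clarify
    fix J assume J: "J \<in> compositions" "nPhi_prod J f \<noteq> 0"
    obtain I where "mcoeff f I * nPhi_prod J (qM I) \<noteq> 0"
      using J(2) unfolding dual_expansion[OF dual_nPhi_prod, of J f]
      by (rule sum.not_neutral_contains_not_neutral)
    then have "mcoeff f I \<noteq> 0" "nPhi_prod J (qM I) \<noteq> 0" by auto
    then show "J \<in> (\<Union>I\<in>{I. mcoeff f I \<noteq> 0}. {J \<in> compositions. sum_list J = sum_list I})"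
      using J nPhi_prod_qM_nonzero mcoeff_nonzero_composition by blast
  qed
  then have fin: "finite ?D"
    by (rule finite_subset) (intro finite_UN_I finite_mcoeff finite_compositions_of)
  have "f - (\<Sum>J\<in>?D. qscale (nPhi_prod J f) (qP J)) = 0"
  proof (rule nPhi_prod_separates)
    fix K :: "(nat ^ 'a) list" assume K: "K \<in> compositions"
    have "nPhi_prod K (\<Sum>J\<in>?D. qscale (nPhi_prod J f) (qP J))
        = (\<Sum>J\<in>?D. if J = K then nPhi_prod K f else 0)"
      unfolding dual_sum[OF dual_nPhi_prod]
      by (rule sum.cong) (use K in \<open>auto simp: dual_scale nPhi_prod_qP\<close>)
    also have "\<dots> = nPhi_prod K f" using fin K by simp
    finally show "nPhi_prod K (f - (\<Sum>J\<in>?D. qscale (nPhi_prod J f) (qP J))) = 0"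
      by (simp add: dual_diff)
  qed
  then have f: "f = (\<Sum>J\<in>?D. qscale (nPhi_prod J f) (qP J))" by simp
  have "(\<Sum>J\<in>?D. qscale (nPhi_prod J f) (qP J)) \<in> qs.span (qP ` G)"
    using assms by (intro qs.span_sum qs.span_scale qs.span_base) auto
  with f show ?thesis by simp
qed

section \<open>Coproduct of the dual basis\<close>

lemma tens_eval_sum:
  assumes "\<And>x. x \<in> A \<Longrightarrow> finite {p. T x p \<noteq> 0}"
  shows "finite {p. (\<Sum>x\<in>A. T x) p \<noteq> 0} \<and>
    tens_eval \<phi> \<psi> (\<Sum>x\<in>A. T x) = (\<Sum>x\<in>A. tens_eval \<phi> \<psi> (T x))"
  using assms
proof (induction A rule: infinite_finite_induct)
  case (insert a A)
  then have fin: "finite {p. T a p \<noteq> 0}" "finite {p. (\<Sum>x\<in>A. T x) p \<noteq> 0}" by auto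
  have "finite {p. (T a + (\<Sum>x\<in>A. T x)) p \<noteq> 0}"
    by (rule finite_subset[OF _ finite_UnI[OF fin]]) auto
  moreover have "(\<Sum>x\<in>insert a A. T x) = T a + (\<Sum>x\<in>A. T x)"
    by (rule sum.insert) (use insert in auto)
  moreover have "tens_eval \<phi> \<psi> (T a + (\<Sum>x\<in>A. T x)) = (\<Sum>x\<in>insert a A. tens_eval \<phi> \<psi> (T x))"
    unfolding tens_eval_add[OF fin] using insert by auto
  ultimately show ?case by (simp only: simp_thms)
qed auto

text \<open>The pairing of \<Phi>^J \<otimes> \<Phi>^K with the M_J' \<otimes> M_K' is a product of
  two triangular pairings, hence triangular for the total length.\<close>

lemma tens_eval_nPhi_prod_separates:
  assumes fin: "finite {p. T p \<noteq> 0}" and supp: "{p. T p \<noteq> 0} \<subseteq> compositions \<times> compositions"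
    and zero: "\<And>J K. J \<in> compositions \<Longrightarrow> K \<in> compositions \<Longrightarrow>
      tens_eval (nPhi_prod J) (nPhi_prod K) T = 0"
  shows "T = 0"
proof (rule ccontr)
  assume "T \<noteq> 0"
  let ?S = "{p. T p \<noteq> 0}"
  let ?A = "\<lambda>p q. nPhi_prod (fst p) (qM (fst q)) * nPhi_prod (snd p) (qM (snd q))"
  have "\<exists>p\<in>?S. (\<Sum>q\<in>?S. T q * ?A p q) \<noteq> 0"
  proof (rule triangular_separation[where size = "\<lambda>p. length (fst p) + length (snd p)"])
    show "?S \<noteq> {}" using \<open>T \<noteq> 0\<close> by (auto simp: fun_eq_iff)
    fix p assume p: "p \<in> ?S"
    then have "fst p \<in> compositions" "snd p \<in> compositions" using supp by auto
    then show "?A p p \<noteq> 0" by (simp add: nPhi_prod_qM_self)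
  next
    fix p q assume "p \<in> ?S" "q \<in> ?S" and A: "?A p q \<noteq> 0"
    then have "fst q \<in> compositions" "snd q \<in> compositions" using supp by auto
    with A show "p = q \<or> length (fst p) + length (snd p) < length (fst q) + length (snd q)"
      using nPhi_prod_qM_nonzero[of "fst q" "fst p"] nPhi_prod_qM_nonzero[of "snd q" "snd p"]
      by (auto simp: prod_eq_iff)
  qed (use fin in auto)
  then obtain p where p: "p \<in> ?S" "(\<Sum>q\<in>?S. T q * ?A p q) \<noteq> 0" by blast
  then show False
    using zero[of "fst p" "snd p"] supp tens_eval_eq_sum[OF fin order_refl, of "nPhi_prod (fst p)"]
    by auto
qed

text \<open>Pairing \<Delta> P_I with \<Phi>^J \<otimes> \<Phi>^K evaluates \<Phi>^(JK) at P_I,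
  which is 1 if JK = I and 0 otherwise. The right-hand side has the same pairings.\<close>

lemma coprod_qP:
  assumes I: "I \<in> compositions"
  shows "coprod (qP I) = (\<Sum>(J, K) | J @ K = I. tens (qP J) (qP K))"
proof -
  let ?D = "{p. fst p @ snd p = I}"
  let ?t = "\<lambda>p. tens (qP (fst p)) (qP (snd p))"
  let ?U = "\<Sum>p\<in>?D. ?t p"
  let ?T = "coprod (qP I) + fscale (-1) ?U"
  have finD: "finite ?D" using finite_splits[of I] by (simp add: split_def)
  have U: "finite {p. ?U p \<noteq> 0}" "tens_eval \<phi> \<psi> ?U = (\<Sum>p\<in>?D. tens_eval \<phi> \<psi> (?t p))" for \<phi> \<psi>
    using tens_eval_sum[of ?D ?t \<phi> \<psi>] by (auto simp: finite_tens)
  have U': "finite {p. fscale (-1) ?U p \<noteq> 0}" using U(1) by (simp add: fscale_apply)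
  have "?T = 0"
  proof (rule tens_eval_nPhi_prod_separates)
    show "finite {p. ?T p \<noteq> 0}"
      by (rule finite_subset[OF _ finite_UnI[OF finite_coprod U']]) auto
    show "{p. ?T p \<noteq> 0} \<subseteq> compositions \<times> compositions"
    proof clarify
      fix J K assume "?T (J, K) \<noteq> 0"
      then consider "coprod (qP I) (J, K) \<noteq> 0" | "?U (J, K) \<noteq> 0"
        by (cases "coprod (qP I) (J, K) = 0") (auto simp: fscale_apply)
      then show "J \<in> compositions \<and> K \<in> compositions"
      proof cases
        case 1
        then show ?thesis
          using mcoeff_nonzero_composition[of "qP I" "J @ K"] by (simp add: coprod_apply)
      next
        case 2
        then obtain p where "?t p (J, K) \<noteq> 0"
          unfolding sum_apply by (rule sum.not_neutral_contains_not_neutral)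
        then show ?thesis
          using mcoeff_nonzero_composition by (auto simp: tens_def)
      qed
    qed
    fix J K :: "(nat ^ 'a) list" assume J: "J \<in> compositions" "K \<in> compositions"
    have "tens_eval (nPhi_prod J) (nPhi_prod K) (coprod (qP I)) = (if J @ K = I then 1 else 0)"
      using nPhi_prod_qP[OF I, of "J @ K"] J by (simp add: nPhi_prod_append conv_def)
    moreover have "tens_eval (nPhi_prod J) (nPhi_prod K) ?U = (\<Sum>p\<in>?D. if p = (J, K) then 1 else 0)"
      unfolding U(2)
      by (rule sum.cong) (use I J in \<open>auto simp: tens_eval_tens nPhi_prod_qP split: if_splits\<close>)
    ultimately show "tens_eval (nPhi_prod J) (nPhi_prod K) ?T = 0"
      unfolding tens_eval_add[OF finite_coprod U'] tens_eval_scale using finD by simp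
  qed
  then show ?thesis by (simp add: fun_eq_iff fscale_apply split_def)
qed

section \<open>Annihilators of subcoalgebras\<close>

definition annihilator :: "'l::finite qsym set \<Rightarrow> ('l qsym \<Rightarrow> rat) set" where
  "annihilator C = {\<phi> \<in> carrier NSym. \<forall>f\<in>C. \<phi> f = 0}"

lemma tens_eval_span_eq_0:
  assumes "dual \<phi>" "dual \<psi>" "(\<forall>f\<in>C. \<phi> f = 0) \<or> (\<forall>f\<in>C. \<psi> f = 0)"
    and "T \<in> fs.span {tens g h | g h. g \<in> C \<and> h \<in> C}"
  shows "finite {p. T p \<noteq> 0} \<and> tens_eval \<phi> \<psi> T = 0"
  using assms(4)
proof (induction rule: fs.span_induct_alt)
  case (step c x y)
  then obtain g h where x: "x = tens g h" "g \<in> C" "h \<in> C" by blast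
  have fin: "finite {p. fscale c x p \<noteq> 0}"
    by (rule finite_subset[OF _ finite_tens[of g h]]) (auto simp: x fscale_apply)
  have "finite {p. (fscale c x + y) p \<noteq> 0}"
    by (rule finite_subset[OF _ finite_UnI[OF fin, of "{p. y p \<noteq> 0}"]]) (use step in auto)
  moreover have "tens_eval \<phi> \<psi> x = 0" using x assms by (auto simp: tens_eval_tens)
  moreover have "tens_eval \<phi> \<psi> (fscale c x + y) = c * tens_eval \<phi> \<psi> x + tens_eval \<phi> \<psi> y"
    using step fin by (subst tens_eval_add) (auto simp: tens_eval_scale)
  ultimately show ?case using step by (simp add: plus_fun_def)
qed (simp add: tens_eval_def)

text \<open>The coproduct of an f in C is a combination of g \<otimes> h with both factors in C, so
  a convolution vanishes at f as soon as either of its factors annihilates C.\<close>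

lemma ideal_annihilator:
  assumes C: "graded_subcoalgebra C"
  shows "ideal (annihilator C) NSym"
proof (rule idealI[OF ring_NSym])
  interpret ring "NSym :: ('a qsym \<Rightarrow> rat) ring" by (rule ring_NSym)
  show "subgroup (annihilator C) (add_monoid NSym)"
  proof (rule add.subgroupI)
    show "annihilator C \<noteq> {}" using NSym_zero by (auto simp: annihilator_def)
    fix \<phi> assume \<phi>: "\<phi> \<in> annihilator C"
    then have "\<ominus>\<^bsub>NSym\<^esub> \<phi> = - \<phi>"
      by (intro minus_equality) (auto simp: annihilator_def NSym_uminus)
    then show "\<ominus>\<^bsub>NSym\<^esub> \<phi> \<in> annihilator C"
      using \<phi> by (auto simp: annihilator_def NSym_uminus)
  qed (auto simp: annihilator_def NSym_add)
  have *: "coprod f \<in> fs.span {tens g h | g h. g \<in> C \<and> h \<in> C}" if "f \<in> C" for f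
    using C that by (simp add: graded_subcoalgebra_def)
  fix \<phi> \<psi> :: "'a qsym \<Rightarrow> rat" assume \<phi>: "\<phi> \<in> annihilator C" and \<psi>: "\<psi> \<in> carrier NSym"
  then show "\<psi> \<otimes>\<^bsub>NSym\<^esub> \<phi> \<in> annihilator C" "\<phi> \<otimes>\<^bsub>NSym\<^esub> \<psi> \<in> annihilator C"
    using tens_eval_span_eq_0[OF _ _ _ *, of \<phi> \<psi>] tens_eval_span_eq_0[OF _ _ _ *, of \<psi> \<phi>]
    by (auto simp: annihilator_def NSym_conv conv_def NSym_dual)
qed

text \<open>As C is graded, its elements of degree n are exactly the components
  \<open>hcomp n f\<close> with f in C. The condition in degree n thus says that the generator of
  that degree annihilates C.\<close>

lemma odd_condition_iff_annihilator:
  assumes C: "graded_subcoalgebra C"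
  shows "(\<forall>n. evec n \<le> k \<longrightarrow> (\<forall>h \<in> C \<inter> homog n. zeta_bar h = zeta_inv h)) \<longleftrightarrow>
    (\<forall>n. 0 < n \<and> evec n \<le> k \<and> even (weight n) \<longrightarrow> nPhi n \<in> annihilator C)"
proof -
  have "(\<forall>h \<in> C \<inter> homog n. zeta_bar h = zeta_inv h) \<longleftrightarrow> bar_series n - inv_series n \<in> annihilator C"
    for n
  proof -
    have "(bar_series n - inv_series n) f = zeta_bar (hcomp n f) - zeta_inv (hcomp n f)" for f
      by (simp add: deg_part_def flip: odd_generator_eq)
    then have "bar_series n - inv_series n \<in> annihilator C
        \<longleftrightarrow> (\<forall>f\<in>C. zeta_bar (hcomp n f) = zeta_inv (hcomp n f))"
      unfolding annihilator_def by (simp add: NSym_diff del: minus_apply)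
    also have "\<dots> \<longleftrightarrow> (\<forall>h \<in> C \<inter> homog n. zeta_bar h = zeta_inv h)"
      using C hcomp_in_homog[of n] hcomp_homog[of _ n n]
      unfolding graded_subcoalgebra_def by fastforce
    finally show ?thesis ..
  qed
  then show ?thesis
    using odd_generators_iff_even_nPhi[OF ideal_annihilator[OF C], of k] by simp
qed

section \<open>The span of the odd P_I as the largest admissible subcoalgebra\<close>

definition odd_compositions :: "enat ^ 'l::finite \<Rightarrow> (nat ^ 'l) list set" where
  "odd_compositions k = {I \<in> compositions. \<forall>i\<in>set I. evec i \<le> k \<longrightarrow> odd (weight i)}"

text \<open>Consecutive pieces of a composition inherit the parity condition, so every term of
  \<Delta> P_I stays within the span; homogeneity of P_I gives the grading.\<close>

lemma graded_subcoalgebra_span_qP: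
  "graded_subcoalgebra (qs.span (qP ` odd_compositions k))" (is "graded_subcoalgebra ?W")
  unfolding graded_subcoalgebra_def
proof (intro conjI ballI allI)
  fix f assume "f \<in> ?W"
  then show "coprod f \<in> fs.span {tens g h | g h. g \<in> ?W \<and> h \<in> ?W}"
  proof (induction rule: qs.span_induct_alt)
    case base
    have "coprod (0 :: 'a qsym) = 0" using coprod_scale[of 0 0] by simp
    then show ?case by (simp only: fs.span_zero)
  next
    case (step c x y)
    then obtain I where I: "x = qP I" "I \<in> odd_compositions k" by blast
    have "coprod x \<in> fs.span {tens g h | g h. g \<in> ?W \<and> h \<in> ?W}"
    proof -
      have "tens (qP J) (qP K) \<in> fs.span {tens g h | g h. g \<in> ?W \<and> h \<in> ?W}" if "J @ K = I" for J K
      proof -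
        have "qP J \<in> ?W" "qP K \<in> ?W"
          using that I(2) by (auto simp: odd_compositions_def intro!: qs.span_base)
        then show ?thesis by (blast intro: fs.span_base)
      qed
      moreover have "I \<in> compositions" using I(2) by (simp add: odd_compositions_def)
      ultimately show ?thesis unfolding I(1) by (auto simp: coprod_qP intro!: fs.span_sum)
    qed
    with step show ?case
      unfolding coprod_add coprod_scale by (intro fs.span_add fs.span_scale)
  qed
  fix n
  show "hcomp n f \<in> ?W"
    using \<open>f \<in> ?W\<close>
  proof (induction rule: qs.span_induct_alt)
    case (step c x y)
    then obtain I where I: "x = qP I" "I \<in> odd_compositions k" by blast
    then have "hcomp n x = (if sum_list I = n then x else 0)"
      by (intro hcomp_homog) (auto simp: odd_compositions_def intro: qP_homog)
    then have "hcomp n x \<in> ?W" using step(1) by (auto intro: qs.span_base qs.span_zero)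
    with step show ?case
      unfolding hcomp_add hcomp_scale by (intro qs.span_add qs.span_scale)
  qed (simp add: hcomp_0 qs.span_zero)
qed (rule qs.subspace_span)

lemma odd_subalgebra_eq: "odd_subalgebra k = qs.span (qP ` odd_compositions k)"
  unfolding odd_subalgebra_def
proof (rule Greatest_equality)
  let ?W = "qs.span (qP ` odd_compositions k)"
  have "nPhi n \<in> annihilator ?W" if n: "0 < n" "evec n \<le> k" "even (weight n)" for n
  proof -
    \<comment> \<open>\<Phi>_n is \<Phi>^J for the one-part composition J = (n), which violates the
      parity condition and so differs from I.\<close>
    have "nPhi n (qP I) = 0" if "I \<in> odd_compositions k" for I
      using nPhi_prod_qP[of I "[n]"] that n
      by (auto simp: odd_compositions_def conv_counit_right NSym_dual split: if_splits)
    then have "nPhi n f = 0" if "f \<in> ?W" for f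
      using dual_span_eq_0[OF NSym_dual[OF NSym_nPhi], of "qP ` odd_compositions k" n f] that
      by blast
    then show ?thesis by (simp add: annihilator_def)
  qed
  then show "graded_subcoalgebra ?W \<and>
      (\<forall>n. evec n \<le> k \<longrightarrow> (\<forall>h\<in>?W \<inter> homog n. zeta_bar h = zeta_inv h))"
    by (simp add: odd_condition_iff_annihilator graded_subcoalgebra_span_qP)
next
  fix C :: "'a qsym set"
  assume C: "graded_subcoalgebra C \<and>
      (\<forall>n. evec n \<le> k \<longrightarrow> (\<forall>h\<in>C \<inter> homog n. zeta_bar h = zeta_inv h))"
  then have ann: "nPhi n \<in> annihilator C" if "0 < n" "evec n \<le> k" "even (weight n)" for n
    using that odd_condition_iff_annihilator[of C k] by blast
  have ideal: "ideal (annihilator C) NSym" using C ideal_annihilator by blast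
  show "C \<subseteq> qs.span (qP ` odd_compositions k)"
  proof
    fix f assume f: "f \<in> C"
    show "f \<in> qs.span (qP ` odd_compositions k)"
    proof (rule in_span_qP)
      fix J assume J: "J \<in> compositions" "J \<notin> odd_compositions k"
      then obtain m where m: "m \<in> set J" "evec m \<le> k" "even (weight m)"
        by (auto simp: odd_compositions_def)
      then obtain J1 J2 where J12: "J = J1 @ m # J2" by (meson split_list)
      have "nPhi m \<in> annihilator C" using m J J12 by (intro ann) auto
      \<comment> \<open>The forbidden entry m puts the whole product into the annihilator, which
        absorbs factors on both sides.\<close>
      then have "nPhi_prod J \<in> annihilator C"
        unfolding J12 nPhi_prod_append nPhi_prod_Cons
        by (intro NSym_ideal_conv_left[OF ideal] NSym_ideal_conv_right[OF ideal]) auto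
      then show "nPhi_prod J f = 0" using f by (simp add: annihilator_def)
    qed
  qed
qed

theorem theorem5p1:
  fixes k :: "enat ^ 'l::finite"
  shows "odd_ideal k =
           genideal NSym {nPhi n | n. 0 < n \<and> evec n \<le> k \<and> even (weight n)} \<and>
         odd_subalgebra k =
           qs.span {qP I | I. I \<in> compositions \<and>
                              (\<forall>i\<in>set I. evec i \<le> k \<longrightarrow> odd (weight i))}"
proof -
  have "{qP I | I. I \<in> compositions \<and> (\<forall>i\<in>set I. evec i \<le> k \<longrightarrow> odd (weight i))}
      = qP ` odd_compositions k"
    by (auto simp: odd_compositions_def)
  then show ?thesis by (simp only: odd_ideal_eq odd_subalgebra_eq)
qed

end
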